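(* There exists a randomized online bipartite edge-coloring algorithm (under one-sided node arrivals, with known maximum degree $\Delta$) that is $\Big(\frac{e}{e-1}+100\sqrt[11]{\frac{\ln n}{\Delta}}\Big)$-competitive with high probability against an adaptive adversary, provided $\Delta\ge 10^{11}\ln n$. In particular, for $\Delta=\omega(\log n)$ this algorithm's competitive ratio is $\frac{e}{e-1}+o(1)$.
   Context: Online bipartite edge coloring under one-sided node arrivals: the input is a bipartite graph with $n$ offline nodes known up front and $n$ online nodes $v_1,\dots,v_n$; at time $t$ the node $v_t$ is revealed with all its edges to offline nodes, and the algorithm must immediately and irrevocably color these edges so that no two edges sharing an endpoint get the same color. The maximum degree $\Delta$ is known in advance. A randomized algorithm is $\alpha$-competitive with high probability if on every input of maximum degree $\Delta$ it uses at most $\alpha\Delta$ colors with probability at least $1-1/n^{c}$ for some constant $c>1$. Against an adaptive adversary, the input (each arriving node's neighborhood) may be chosen as a function of the algorithm's random choices so far. *)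

theory Defs
  imports "HOL-Probability.Probability" "HOL-Library.Landau_Symbols"
begin

(* Online nodes are the arrival times 0, ..., n - 1 and offline nodes are 0, ..., n - 1.  An edge
   (t, u) joins online node t to offline node u, so the two sides are disjoint by position.
   Colors are natural numbers. *)

definition max_degree :: "nat \<Rightarrow> (nat \<times> nat) set \<Rightarrow> nat" where
  "max_degree n E = Max ((\<lambda>t. card (E `` {t})) ` {..<n} \<union> (\<lambda>u. card (E\<inverse> `` {u})) ` {..<n})"

definition proper_edge_coloring :: "(nat \<times> nat) set \<Rightarrow> (nat \<times> nat \<Rightarrow> nat) \<Rightarrow> bool" where
  "proper_edge_coloring E col \<longleftrightarrow>
     (\<forall>e\<in>E. \<forall>e'\<in>E. e \<noteq> e' \<and> (fst e = fst e' \<or> snd e = snd e') \<longrightarrow> col e \<noteq> col e')"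

(* Entry t of a history records the neighborhood revealed at time t together with the outcome of
   all random choices the algorithm makes at that time (encoded as a natural number). *)

type_synonym history = "(nat set \<times> nat) list"

(* Both fields take n, the maximum degree, the history before the current arrival and the current
   neighborhood.  The field draw gives the distribution of the current random choices, and color
   maps their outcome to the colors of the new edges, indexed by their offline endpoints.  All
   randomness is in draw, and colors cannot depend on later arrivals or later random choices. *)

record online_algorithm =
  draw :: "nat \<Rightarrow> nat \<Rightarrow> history \<Rightarrow> nat set \<Rightarrow> nat pmf"
  color :: "nat \<Rightarrow> nat \<Rightarrow> history \<Rightarrow> nat set \<Rightarrow> nat \<Rightarrow> nat \<Rightarrow> nat"

(* An adaptive adversary sees all earlier random choices of the algorithm, not only the colors. *)

type_synonym adversary = "history \<Rightarrow> nat set"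

primrec run :: "online_algorithm \<Rightarrow> nat \<Rightarrow> nat \<Rightarrow> adversary \<Rightarrow> nat \<Rightarrow> history pmf" where
  "run A n \<Delta> adv 0 = return_pmf []"
| "run A n \<Delta> adv (Suc t) =
     bind_pmf (run A n \<Delta> adv t) (\<lambda>h.
     bind_pmf (draw A n \<Delta> h (adv h)) (\<lambda>r.
     return_pmf (h @ [(adv h, r)])))"

definition edges :: "history \<Rightarrow> (nat \<times> nat) set" where
  "edges h = {(t, u). t < length h \<and> u \<in> fst (h ! t)}"

definition coloring :: "online_algorithm \<Rightarrow> nat \<Rightarrow> nat \<Rightarrow> history \<Rightarrow> nat \<times> nat \<Rightarrow> nat" where
  "coloring A n \<Delta> h = (\<lambda>(t, u). color A n \<Delta> (take t h) (fst (h ! t)) (snd (h ! t)) u)"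

definition legal_adversary :: "online_algorithm \<Rightarrow> nat \<Rightarrow> nat \<Rightarrow> adversary \<Rightarrow> bool" where
  "legal_adversary A n \<Delta> adv \<longleftrightarrow>
     (\<forall>h \<in> set_pmf (run A n \<Delta> adv n).
        edges h \<subseteq> {..<n} \<times> {..<n} \<and> max_degree n (edges h) = \<Delta>)"

(* Properness is required on every run, not just with high probability, and for all n and all
   maximum degrees. *)

definition online_edge_coloring_algorithm :: "online_algorithm \<Rightarrow> bool" where
  "online_edge_coloring_algorithm A \<longleftrightarrow>
     (\<forall>n \<Delta> adv. n \<ge> 1 \<and> legal_adversary A n \<Delta> adv \<longrightarrow>
        (\<forall>h \<in> set_pmf (run A n \<Delta> adv n). proper_edge_coloring (edges h) (coloring A n \<Delta> h)))"

(* P is the range of parameters (n, maximum degree) considered.  The constant c is uniform over P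
   and over all adversaries. *)

definition competitive_whp ::
    "online_algorithm \<Rightarrow> (nat \<Rightarrow> nat \<Rightarrow> real) \<Rightarrow> (nat \<times> nat) set \<Rightarrow> bool" where
  "competitive_whp A \<alpha> P \<longleftrightarrow>
     (\<exists>c>1. \<forall>(n, \<Delta>) \<in> P. \<forall>adv. legal_adversary A n \<Delta> adv \<longrightarrow>
        measure_pmf.prob (run A n \<Delta> adv n)
          {h. real (card (coloring A n \<Delta> h ` edges h)) \<le> \<alpha> n \<Delta> * real \<Delta>}
        \<ge> 1 - 1 / real n powr c)"

end

theory Submission imports Defs begin

text \<open>
  The strategy is deterministic, obtained by conditional expectations, and it colors in rounds, each
  of which halves the maximum degree \<open>D\<close> using \<open>3/4 D\<close> fresh colors. Three rounds
  followed by greedy coloring use \<open>(3/4) (1 + 1/2 + 1/4) \<Delta> + 2 \<Delta>/8 + O(1) < 1.58 \<Delta>\<close>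
  colors, which is below \<open>e/(e-1) \<Delta>\<close>; when \<open>ln n / \<Delta>\<close> is not tiny, greedy
  coloring with \<open>2 \<Delta>\<close> colors is already within the bound.

  Consider a random round. On an arrival with neighborhood \<open>S\<close>, every color \<open>c\<close> independently
  picks at most one node of \<open>S\<close>, where \<open>u\<close> is picked with probability \<open>y u c / B\<close> and the
  weight \<open>y u c\<close> is the inverse of the probability that \<open>u\<close> has never been picked by
  \<open>c\<close>, or 0 if it has been. Then every \<open>y u c\<close> is a martingale. In each step the weights of
  different colors are independent and those of one color are negatively dependent, so multilinear
  products of them are supermartingales. This makes two events so unlikely that a union bound over all candidate
  neighborhoods works even against an adaptive adversary: that too many colors have total weight above
  \<open>B\<close> on a neighborhood, and that a node has little total weight left. Otherwise each edge is picked by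
  some color with probability above 1/2, and Chernoff bounds control both uncolored degrees. The sum
  of all these exponential moments is the potential that the derandomized strategy keeps below 1.
\<close>

section \<open>Online degree reduction\<close>

definition deg :: "'a set list \<Rightarrow> 'a \<Rightarrow> nat" where
  "deg Ss u = length (filter (\<lambda>S. u \<in> S) Ss)"

lemma deg_Nil [simp]: "deg [] u = 0"
  and deg_snoc [simp]: "deg (Ss @ [S]) u = deg Ss u + of_bool (u \<in> S)"
  by (simp_all add: deg_def)

definition legal :: "nat \<Rightarrow> real \<Rightarrow> nat set list \<Rightarrow> bool" where
  "legal n D Ss \<longleftrightarrow> length Ss \<le> n \<and> (\<forall>S\<in>set Ss. S \<subseteq> {..<n} \<and> real (card S) \<le> D)
     \<and> (\<forall>u. real (deg Ss u) \<le> D)"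

lemma legal_snocD:
  assumes "legal n D (Ss @ [S])"
  shows "legal n D Ss" "length Ss < n" "S \<subseteq> {..<n}" "finite S" "real (card S) \<le> D"
    "\<And>u. u \<in> S \<Longrightarrow> real (deg Ss u) + 1 \<le> D"
proof -
  have d: "real (deg (Ss @ [S]) u) \<le> D" for u using assms unfolding legal_def by simp
  show "real (deg Ss u) + 1 \<le> D" if "u \<in> S" for u using d[of u] that by simp
  have "real (deg Ss u) \<le> D" for u using d[of u] by (cases "u \<in> S") auto
  then show "legal n D Ss" using assms by (simp add: legal_def)
  show "length Ss < n" "S \<subseteq> {..<n}" "real (card S) \<le> D" using assms by (auto simp: legal_def)
  then show "finite S" by (auto intro: finite_subset)
qed

definition left :: "'a set \<times> ('a \<Rightarrow> nat option) \<Rightarrow> 'a set" where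
  "left x = fst x - dom (snd x)"

text \<open>\<open>g\<close> lists the earlier neighborhoods with their partial colorings;
  \<open>None\<close> in \<open>f\<close> leaves an edge for a later strategy. Legality of the whole
  residual history for \<open>R\<close> makes it an input of that strategy.\<close>

definition extends :: "nat \<Rightarrow> real \<Rightarrow> nat \<Rightarrow> (nat set \<times> (nat \<Rightarrow> nat option)) list \<Rightarrow> nat set
    \<Rightarrow> (nat \<Rightarrow> nat option) \<Rightarrow> bool" where
  "extends n R C g S f \<longleftrightarrow> dom f \<subseteq> S \<and> ran f \<subseteq> {..<C} \<and> inj_on f (dom f)
     \<and> (\<forall>(S', f')\<in>set g. \<forall>u\<in>dom f \<inter> dom f'. f u \<noteq> f' u)
     \<and> legal n R (map left (g @ [(S, f)]))"

lemma extendsD: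
  assumes "extends n R C g S f"
  shows "dom f \<subseteq> S" "f u = Some c \<Longrightarrow> c < C" "inj_on f (dom f)" "legal n R (map left (g @ [(S, f)]))"
    "(S', f') \<in> set g \<Longrightarrow> f u = Some c \<Longrightarrow> f' u \<noteq> Some c"
proof -
  show "dom f \<subseteq> S" "inj_on f (dom f)" "legal n R (map left (g @ [(S, f)]))"
    using assms by (simp_all add: extends_def)
  show "c < C" if "f u = Some c"
    using assms that by (auto simp: extends_def ran_def)
  show "f' u \<noteq> Some c" if "(S', f') \<in> set g" "f u = Some c"
  proof
    assume "f' u = Some c"
    with that(2) have "u \<in> dom f \<inter> dom f'" by blast
    moreover have "\<forall>u\<in>dom f \<inter> dom f'. f u \<noteq> f' u" using assms that(1) unfolding extends_def by blast
    ultimately have "f u \<noteq> f' u" by (rule bspec[rotated])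
    then show False using that(2) \<open>f' u = Some c\<close> by simp
  qed
qed

text \<open>An online strategy is represented by an invariant of its histories that can always be
  maintained; the residual graphs of one strategy are legal inputs of the next one.\<close>

definition reducible :: "nat \<Rightarrow> real \<Rightarrow> nat \<Rightarrow> real \<Rightarrow> bool" where
  "reducible n D C R \<longleftrightarrow> (\<exists>Inv. Inv [] \<and> (\<forall>g S. Inv g \<and> legal n D (map fst g @ [S]) \<longrightarrow>
     (\<exists>f. extends n R C g S f \<and> Inv (g @ [(S, f)]))))"

text \<open>The second strategy runs on the edges that the first leaves uncolored, with its colors
  shifted by \<open>C\<close>, so the palettes are disjoint.\<close>

lemma reducible_trans:
  assumes "reducible n D C R" and "reducible n R C' R'"
  shows "reducible n D (C + C') R'"
proof -
  obtain I1 where I1: "I1 []" "\<And>g S. I1 g \<Longrightarrow> legal n D (map fst g @ [S]) \<Longrightarrow>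
     \<exists>f. extends n R C g S f \<and> I1 (g @ [(S, f)])" using assms(1) unfolding reducible_def by blast
  obtain I2 where I2: "I2 []" "\<And>g S. I2 g \<Longrightarrow> legal n R (map fst g @ [S]) \<Longrightarrow>
     \<exists>f. extends n R' C' g S f \<and> I2 (g @ [(S, f)])" using assms(2) unfolding reducible_def by blast
  define join :: "(nat \<Rightarrow> nat option) \<Rightarrow> (nat \<Rightarrow> nat option) \<Rightarrow> nat \<Rightarrow> nat option" where
    "join f1 f2 = (\<lambda>u. case f1 u of Some c \<Rightarrow> Some c | None \<Rightarrow> map_option ((+) C) (f2 u))" for f1 f2
  have dom_join: "dom (join f1 f2) = dom f1 \<union> dom f2" for f1 f2
    by (auto simp: join_def dom_def split: option.splits)
  define first where "first = (\<lambda>(S, f1, f2 :: nat \<Rightarrow> nat option). (S :: nat set, f1 :: nat \<Rightarrow> nat option))"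
  define second where "second = (\<lambda>(S :: nat set, f1 :: nat \<Rightarrow> nat option, f2 :: nat \<Rightarrow> nat option). (S - dom f1, f2))"
  define both where "both = (\<lambda>(S :: nat set, f1, f2). (S, join f1 f2))"
  \<comment> \<open>The triples project to histories of both strategies. The range of each
    \<open>f1\<close> is recorded so that its colors cannot be mistaken for shifted ones.\<close>
  define Inv where "Inv g \<longleftrightarrow> (\<exists>xs. I1 (map first xs) \<and> I2 (map second xs) \<and> g = map both xs
    \<and> (\<forall>(S, f1, f2)\<in>set xs. ran f1 \<subseteq> {..<C}))" for g
  have lefts: "map left (map both xs) = map left (map second xs)" for xs
  proof -
    have "left (both x) = left (second x)" for x
      by (cases x) (simp add: left_def both_def second_def dom_join, blast)
    then show ?thesis by simp
  qed
  have seconds: "map fst (map second xs) = map left (map first xs)" for xs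
    by (auto simp: left_def first_def second_def)
  have "\<exists>f. extends n R' (C + C') g S f \<and> Inv (g @ [(S, f)])"
    if "Inv g" and leg: "legal n D (map fst g @ [S])" for g S
  proof -
    obtain xs where xs: "I1 (map first xs)" "I2 (map second xs)" "g = map both xs"
      "\<And>S f1 f2. (S, f1, f2) \<in> set xs \<Longrightarrow> ran f1 \<subseteq> {..<C}"
      using \<open>Inv g\<close> unfolding Inv_def by blast
    have "map fst g = map fst (map first xs)" using xs(3) by (auto simp: both_def first_def)
    with leg have "legal n D (map fst (map first xs) @ [S])" by (simp only:)
    from I1(2)[OF xs(1) this] obtain f1 where f1: "extends n R C (map first xs) S f1"
      "I1 (map first xs @ [(S, f1)])" by blast
    let ?S2 = "S - dom f1"
    have "legal n R (map fst (map second xs) @ [?S2])"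
      using f1(1) unfolding seconds by (simp add: extends_def left_def)
    from I2(2)[OF xs(2) this] obtain f2 where f2: "extends n R' C' (map second xs) ?S2 f2"
      "I2 (map second xs @ [(?S2, f2)])" by blast
    let ?xs = "xs @ [(S, f1, f2)]" and ?f = "join f1 f2"
    note f1D = extendsD[OF f1(1)] and f2D = extendsD[OF f2(1)]
    have lt: "c < C" if "f1 u = Some c" for u c using f1D(2)[OF that] .
    have f2_cases: "f1 u = Some c \<or> C \<le> c \<and> f2 u = Some (c - C)" if "?f u = Some c" for u c
      using that by (auto simp: join_def split: option.splits)
    have "ran ?f \<subseteq> {..<C + C'}"
    proof
      fix c assume "c \<in> ran ?f"
      then obtain u where "?f u = Some c" by (auto simp: ran_def)
      then show "c \<in> {..<C + C'}" using f2_cases f1D(2)[of u c] f2D(2)[of u "c - C"] by fastforce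
    qed
    moreover have "inj_on ?f (dom ?f)"
    proof (rule inj_onI)
      fix u v assume "u \<in> dom ?f" "v \<in> dom ?f" "?f u = ?f v"
      then obtain c where c: "?f u = Some c" "?f v = Some c" by auto
      show "u = v"
      proof (cases "c < C")
        case True
        then have "f1 u = Some c" "f1 v = Some c" using c f2_cases by (meson not_le)+
        then show ?thesis using f1D(3) by (simp add: inj_on_def domI)
      next
        case False
        then have "f2 u = Some (c - C)" "f2 v = Some (c - C)" using c f2_cases lt by blast+
        then show ?thesis using f2D(3) by (simp add: inj_on_def domI)
      qed
    qed
    moreover have "\<forall>(S', f')\<in>set g. \<forall>u\<in>dom ?f \<inter> dom f'. ?f u \<noteq> f' u"
    proof clarify
      fix S' f' u c c' assume "(S', f') \<in> set g" and c: "?f u = Some c" "f' u = Some c'" "?f u = f' u"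
      then obtain f1' f2' where m: "(S', f1', f2') \<in> set xs" and f': "f' = join f1' f2'"
        by (auto simp: xs(3) both_def)
      have "first (S', f1', f2') \<in> set (map first xs)" "second (S', f1', f2') \<in> set (map second xs)"
        using m by (metis image_eqI list.set_map)+
      then have m1: "(S', f1') \<in> set (map first xs)" and m2: "(S' - dom f1', f2') \<in> set (map second xs)"
        by (simp_all only: first_def second_def prod.case)
      have lt': "c < C" if "f1' u = Some c" for c using xs(4)[OF m] that by (auto simp: ran_def)
      have c': "join f1' f2' u = Some c" using c f' by simp
      then have "f1' u = Some c \<or> C \<le> c \<and> f2' u = Some (c - C)"
        by (auto simp: join_def split: option.splits)
      with f2_cases[OF c(1)] show False
        using lt[of u c] lt'[of c] f1D(5)[OF m1, of u c] f2D(5)[OF m2, of u "c - C"]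
        by (metis not_le)
    qed
    moreover have "legal n R' (map left (g @ [(S, ?f)]))"
    proof -
      have "map left (g @ [(S, ?f)]) = map left (map both ?xs)" by (simp add: xs(3) both_def)
      also note lefts
      also have "map left (map second ?xs) = map left (map second xs @ [(?S2, f2)])"
        by (simp add: second_def)
      finally have "map left (g @ [(S, ?f)]) = map left (map second xs @ [(?S2, f2)])" .
      then show ?thesis using f2D(4) by simp
    qed
    moreover have "dom ?f \<subseteq> S" unfolding dom_join using f1D(1) f2D(1) by blast
    ultimately have "extends n R' (C + C') g S ?f" by (simp only: extends_def simp_thms)
    moreover have "Inv (g @ [(S, ?f)])"
      unfolding Inv_def
    proof (intro exI[of _ ?xs] conjI ballI)
      show "I1 (map first ?xs)" using f1(2) by (simp add: first_def)
      show "I2 (map second ?xs)" using f2(2) by (simp add: second_def)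
      show "g @ [(S, ?f)] = map both ?xs" using xs(3) by (simp add: both_def)
      fix x assume "x \<in> set ?xs"
      then have "x \<in> set xs \<or> x = (S, f1, f2)" by auto
      moreover have "ran f1 \<subseteq> {..<C}" using lt by (auto simp: ran_def)
      ultimately show "case x of (S, f1, f2) \<Rightarrow> ran f1 \<subseteq> {..<C}"
        using xs(4) by (cases x) (elim disjE, simp_all only: prod.case prod.inject)
    qed
    ultimately show ?thesis by blast
  qed
  moreover have "Inv []" unfolding Inv_def by (rule exI[of _ "[]"]) (simp add: I1(1) I2(1))
  ultimately show ?thesis unfolding reducible_def by blast
qed

text \<open>At a node \<open>a\<close>, fewer than \<open>m\<close> colors lie in \<open>B a\<close>
  and at most \<open>m - 1\<close> are taken by the rest of \<open>S\<close>, so one of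
  \<open>2 * m\<close> colors is free.\<close>

lemma greedy_extension:
  fixes m :: nat
  assumes "finite S" "card S \<le> m" "\<And>u. u \<in> S \<Longrightarrow> finite (B u) \<and> card (B u) < m"
  shows "\<exists>f. dom f = S \<and> ran f \<subseteq> {..<2 * m} \<and> inj_on f (dom f) \<and> (\<forall>u c. f u = Some c \<longrightarrow> c \<notin> B u)"
  using assms
proof (induction S)
  case empty
  show ?case by (intro exI[of _ Map.empty]) auto
next
  case (insert a S)
  obtain f where f: "dom f = S" "ran f \<subseteq> {..<2 * m}" "inj_on f (dom f)" "\<forall>u c. f u = Some c \<longrightarrow> c \<notin> B u"
    using insert by auto
  have "ran f = the ` f ` S" using f(1) by (force simp: ran_def image_iff)
  then have "finite (ran f)" "card (ran f) \<le> card S"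
    using insert.hyps by (simp, metis card_image_le finite_imageI le_trans)
  then have "finite (B a \<union> ran f)" "card (B a \<union> ran f) < 2 * m"
    using insert.prems(2)[of a] insert.prems(1) insert.hyps card_Un_le[of "B a" "ran f"] by auto
  then obtain c where c: "c < 2 * m" "c \<notin> B a" "c \<notin> ran f"
    by (metis (no_types, lifting) UnI1 UnI2 card_lessThan card_mono lessThan_iff not_le subsetI)
  have fa: "f a = None" using f(1) insert.hyps by blast
  have "dom (f(a \<mapsto> c)) = insert a S" using f(1) by simp
  moreover have "ran (f(a \<mapsto> c)) \<subseteq> {..<2 * m}" using f(2) c fa by (auto simp: ran_map_upd)
  moreover have "inj_on (f(a \<mapsto> c)) (dom (f(a \<mapsto> c)))"
  proof (rule inj_onI)
    fix u v assume "u \<in> dom (f(a \<mapsto> c))" "v \<in> dom (f(a \<mapsto> c))" and e: "(f(a \<mapsto> c)) u = (f(a \<mapsto> c)) v"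
    then show "u = v" using c(3) f(3)
      by (auto simp: ran_def inj_on_def split: if_splits)
  qed
  moreover have "\<forall>u c'. (f(a \<mapsto> c)) u = Some c' \<longrightarrow> c' \<notin> B u" using f(4) c(2) by simp
  ultimately show ?case by blast
qed

lemma reducible_greedy:
  assumes "0 \<le> D"
  shows "reducible n D (2 * nat \<lfloor>D\<rfloor>) 0"
proof -
  let ?m = "nat \<lfloor>D\<rfloor>"
  define Inv :: "(nat set \<times> (nat \<Rightarrow> nat option)) list \<Rightarrow> bool" where
    "Inv g \<longleftrightarrow> length g \<le> n \<and> (\<forall>(S, f)\<in>set g. dom f = S)" for g
  have "\<exists>f. extends n 0 (2 * ?m) g S f \<and> Inv (g @ [(S, f)])"
    if I: "Inv g" and L: "legal n D (map fst g @ [S])" for g S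
  proof -
    note L' = legal_snocD[OF L]
    define B where "B u = (\<lambda>x. the (snd x u)) ` set (filter (\<lambda>x. u \<in> fst x) g)" for u
    have "card (B u) < ?m" if "u \<in> S" for u
    proof -
      have "card (B u) \<le> length (filter (\<lambda>x. u \<in> fst x) g)"
        unfolding B_def by (meson card_image_le card_length finite_set le_trans)
      also have "\<dots> = deg (map fst g) u" by (simp add: deg_def filter_map o_def)
      finally show ?thesis using L'(6)[OF that] by linarith
    qed
    moreover have "finite (B u)" for u by (simp add: B_def)
    moreover have "card S \<le> ?m" using L'(5) by linarith
    ultimately obtain f where f: "dom f = S" "ran f \<subseteq> {..<2 * ?m}" "inj_on f (dom f)"
      "\<And>u c. f u = Some c \<Longrightarrow> c \<notin> B u"
      using greedy_extension[of S ?m B] L'(4) by (metis (no_types, lifting))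
    have "left x = {}" if "x \<in> set (g @ [(S, f)])" for x
      using I f(1) that by (auto simp: Inv_def left_def)
    then have "map left (g @ [(S, f)]) = replicate (Suc (length g)) {}"
      by (intro replicate_eqI) auto
    moreover have "legal n 0 (replicate (Suc (length g)) {})"
      using L'(2) by (auto simp: legal_def deg_def)
    moreover have "\<forall>(S', f')\<in>set g. \<forall>u\<in>dom f \<inter> dom f'. f u \<noteq> f' u"
    proof clarify
      fix S' f' u c c' assume m: "(S', f') \<in> set g" and c: "f u = Some c" "f' u = Some c'" "f u = f' u"
      have "dom f' = S'" using I m by (auto simp: Inv_def)
      then have "(S', f') \<in> set (filter (\<lambda>x. u \<in> fst x) g)" using m c by auto
      then have "the (snd (S', f') u) \<in> B u" unfolding B_def by (rule imageI)
      then show False using f(4)[OF c(1)] c by simp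
    qed
    ultimately have "legal n 0 (map left (g @ [(S, f)]))"
      and "\<forall>(S', f')\<in>set g. \<forall>u\<in>dom f \<inter> dom f'. f u \<noteq> f' u" by simp_all
    moreover have "dom f \<subseteq> S" using f(1) by simp
    ultimately have "extends n 0 (2 * ?m) g S f"
      using f(2,3) by (simp only: extends_def simp_thms)
    moreover have "Inv (g @ [(S, f)])" using I f(1) L'(2) by (auto simp: Inv_def)
    ultimately show ?thesis by blast
  qed
  moreover have "Inv []" by (simp add: Inv_def)
  ultimately show ?thesis unfolding reducible_def by blast
qed

text \<open>Choosing an extension at each arrival turns the invariant into a function of the
  neighborhoods seen so far. Residual degree 0 means that no edge stays uncolored.\<close>

lemma reducible_strategy:
  assumes "reducible n D C 0"
  obtains col :: "nat set list \<Rightarrow> nat \<Rightarrow> nat" where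
    "\<And>Ss t u. legal n D Ss \<Longrightarrow> t < length Ss \<Longrightarrow> u \<in> Ss ! t \<Longrightarrow> col (take (Suc t) Ss) u < C"
    "\<And>Ss t. legal n D Ss \<Longrightarrow> t < length Ss \<Longrightarrow> inj_on (col (take (Suc t) Ss)) (Ss ! t)"
    "\<And>Ss s t u. legal n D Ss \<Longrightarrow> s < t \<Longrightarrow> t < length Ss \<Longrightarrow> u \<in> Ss ! s \<inter> Ss ! t \<Longrightarrow>
       col (take (Suc s) Ss) u \<noteq> col (take (Suc t) Ss) u"
proof -
  obtain Inv where I0: "Inv []" and I: "\<And>g S. Inv g \<Longrightarrow> legal n D (map fst g @ [S]) \<Longrightarrow>
     \<exists>f. extends n 0 C g S f \<and> Inv (g @ [(S, f)])" using assms unfolding reducible_def by blast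
  define nxt where "nxt g S = (SOME f. extends n 0 C g S f \<and> Inv (g @ [(S, f)]))" for g S
  have nxt: "extends n 0 C g S (nxt g S) \<and> Inv (g @ [(S, nxt g S)])"
    if "Inv g" "legal n D (map fst g @ [S])" for g S
    unfolding nxt_def using someI_ex[OF I[OF that]] .
  define hist where "hist = foldl (\<lambda>g S. g @ [(S, nxt g S)]) []"
  have hist_snoc: "hist (Ss @ [S]) = hist Ss @ [(S, nxt (hist Ss) S)]" for Ss S
    by (simp add: hist_def)
  have fst_hist: "map fst (hist Ss) = Ss" for Ss
    by (induction Ss rule: rev_induct) (simp_all add: hist_snoc, simp add: hist_def)
  have Inv_hist: "Inv (hist Ss)" if "legal n D Ss" for Ss
    using that
  proof (induction Ss rule: rev_induct)
    case Nil show ?case using I0 by (simp add: hist_def)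
  next
    case (snoc S Ss)
    then show ?case using nxt[of "hist Ss" S] legal_snocD(1) fst_hist by (simp add: hist_snoc)
  qed
  define pc where "pc Ss = snd (last (hist Ss))" for Ss
  have pc: "hist (take (Suc t) Ss) = hist (take t Ss) @ [(Ss ! t, pc (take (Suc t) Ss))]"
    "extends n 0 C (hist (take t Ss)) (Ss ! t) (pc (take (Suc t) Ss))"
    if L: "legal n D Ss" and t: "t < length Ss" for Ss t
  proof -
    have tk: "take (Suc t) Ss = take t Ss @ [Ss ! t]" using t by (rule take_Suc_conv_app_nth)
    show eq: "hist (take (Suc t) Ss) = hist (take t Ss) @ [(Ss ! t, pc (take (Suc t) Ss))]"
      by (simp add: tk hist_snoc pc_def)
    have leg: "legal n D (take k Ss)" for k
      using L
    proof (induction Ss rule: rev_induct)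
      case (snoc S Ss)
      then show ?case using legal_snocD(1)[OF snoc.prems] by (cases "k \<le> length Ss") auto
    qed simp
    have "pc (take (Suc t) Ss) = nxt (hist (take t Ss)) (Ss ! t)" by (simp add: tk hist_snoc pc_def)
    then show "extends n 0 C (hist (take t Ss)) (Ss ! t) (pc (take (Suc t) Ss))"
      using nxt[of "hist (take t Ss)" "Ss ! t"] Inv_hist leg[of t] leg[of "Suc t"] fst_hist tk by simp
  qed
  have dom: "Ss ! t \<subseteq> dom (pc (take (Suc t) Ss))" if "legal n D Ss" "t < length Ss" for Ss t
  proof -
    have "legal n 0 (map left (hist (take t Ss) @ [(Ss ! t, pc (take (Suc t) Ss))]))"
      using pc(2)[OF that] by (simp add: extends_def)
    from legal_snocD(4,5)[of n 0 "map left (hist (take t Ss))"] this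
    have "left (Ss ! t, pc (take (Suc t) Ss)) = {}" by simp
    then show ?thesis by (auto simp: left_def)
  qed
  have mem: "(Ss ! s, pc (take (Suc s) Ss)) \<in> set (hist (take t Ss))"
    if L: "legal n D Ss" and "s < t" "t \<le> length Ss" for Ss s t
    using that(2,3)
  proof (induction t)
    case (Suc t)
    have "hist (take (Suc t) Ss) = hist (take t Ss) @ [(Ss ! t, pc (take (Suc t) Ss))]"
      using pc(1)[OF L, of t] Suc.prems by simp
    then show ?case using Suc by (cases "s = t") auto
  qed simp
  show thesis
  proof (rule that[of "\<lambda>Ss u. the (pc Ss u)"])
    fix Ss t u assume *: "legal n D Ss" "t < length Ss" "u \<in> Ss ! t"
    then obtain c where "pc (take (Suc t) Ss) u = Some c" using dom by blast
    then show "the (pc (take (Suc t) Ss) u) < C"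
      using pc(2)[OF *(1,2)] by (auto simp: extends_def ran_def)
  next
    fix Ss t assume *: "legal n D Ss" "t < length Ss"
    have "inj_on (pc (take (Suc t) Ss)) (dom (pc (take (Suc t) Ss)))"
      using pc(2)[OF *] by (simp add: extends_def)
    then show "inj_on (\<lambda>u. the (pc (take (Suc t) Ss) u)) (Ss ! t)"
      using dom[OF *] unfolding inj_on_def by (metis domIff option.expand subsetD)
  next
    fix Ss s t u assume *: "legal n D Ss" "s < t" "t < length Ss" "u \<in> Ss ! s \<inter> Ss ! t"
    let ?f = "pc (take (Suc s) Ss)" and ?g = "pc (take (Suc t) Ss)"
    have "u \<in> dom ?f" "u \<in> dom ?g" using dom[OF *(1), of s] dom[OF *(1), of t] * by auto
    then obtain b c where "?f u = Some b" "?g u = Some c" by blast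
    moreover have "?f u \<noteq> Some c"
      using extendsD(5)[OF pc(2)[OF *(1,3)] mem[OF *(1,2)]] *(3) \<open>?g u = Some c\<close> by simp
    ultimately show "the (?f u) \<noteq> the (?g u)" by auto
  qed
qed

section \<open>Independent picks by the colors\<close>

definition choices :: "'a set \<Rightarrow> 'a option set" where
  "choices S = insert None (Some ` S)"

definition pick_weight :: "'a set \<Rightarrow> ('a \<Rightarrow> real) \<Rightarrow> 'a option \<Rightarrow> real" where
  "pick_weight S p x = (case x of None \<Rightarrow> 1 - sum p S | Some u \<Rightarrow> p u)"

lemma finite_choices: "finite S \<Longrightarrow> finite (choices S)"
  by (simp add: choices_def)

lemma sum_choices:
  assumes "finite S"
  shows "(\<Sum>x\<in>choices S. pick_weight S p x * h x)
    = (1 - sum p S) * h None + (\<Sum>u\<in>S. p u * h (Some u))"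
proof -
  have "(\<Sum>x\<in>Some ` S. pick_weight S p x * h x) = (\<Sum>u\<in>S. p u * h (Some u))"
    by (subst sum.reindex) (auto simp: pick_weight_def)
  moreover have "None \<notin> Some ` S" by auto
  ultimately show ?thesis
    unfolding choices_def using assms by (subst sum.insert) (auto simp: pick_weight_def)
qed

lemma pick_weight_nonneg:
  assumes "\<And>u. 0 \<le> p u" "sum p S \<le> 1"
  shows "0 \<le> pick_weight S p x"
  using assms by (auto simp: pick_weight_def split: option.splits)

lemma sum_choices_single:
  assumes "finite S" "\<And>v. v \<notin> S \<Longrightarrow> p v = 0"
  shows "(\<Sum>x\<in>choices S. pick_weight S p x * (if x = Some u then l else b)) = p u * l + (1 - p u) * b"
proof -
  have "(\<Sum>v\<in>S. p v * (if v = u then l else b)) = (\<Sum>v\<in>S. p v * b + (if v = u then p u * (l - b) else 0))"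
    by (intro sum.cong) (auto simp: algebra_simps)
  also have "\<dots> = sum p S * b + p u * (l - b)"
    using assms by (auto simp: sum.distrib sum_distrib_right)
  finally show ?thesis using assms(1) by (simp add: sum_choices algebra_simps)
qed

text \<open>At most one node is picked, so the per-node outcomes are negatively dependent.\<close>

lemma sum_choices_prod_le:
  assumes S: "finite S" and p: "\<And>v. 0 \<le> p v" "\<And>v. v \<notin> S \<Longrightarrow> p v = 0" "sum p S \<le> 1"
    and A: "finite A" and lb: "\<And>v. 0 \<le> l v" "\<And>v. l v \<le> b v"
  shows "(\<Sum>x\<in>choices S. pick_weight S p x * (\<Prod>v\<in>A. if x = Some v then l v else b v))
    \<le> (\<Prod>v\<in>A. p v * l v + (1 - p v) * b v)"
  using A
proof (induction A)
  case empty
  show ?case using sum_choices[OF S, of p "\<lambda>_. 1"] by simp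
next
  case (insert a A)
  let ?q = "pick_weight S p" and ?P = "\<lambda>x. \<Prod>v\<in>A. if x = Some v then l v else b v"
  let ?E = "\<Sum>x\<in>choices S. ?q x * ?P x"
  have p1: "p v \<le> 1" for v
  proof (cases "v \<in> S")
    case True
    then have "p v \<le> sum p S" using S p(1) by (intro member_le_sum) auto
    then show ?thesis using p(3) by simp
  next
    case False then show ?thesis using p(2) by simp
  qed
  have b0: "0 \<le> b v" for v using lb[of v] by linarith
  have E_le: "?E \<le> (\<Prod>v\<in>A. b v)"
  proof -
    have "?E \<le> (\<Sum>x\<in>choices S. ?q x * (\<Prod>v\<in>A. b v))"
      using lb b0 by (intro sum_mono mult_left_mono prod_mono pick_weight_nonneg p) auto
    also have "\<dots> = (\<Prod>v\<in>A. b v)"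
      using sum_choices[OF S, of p "\<lambda>_. \<Prod>v\<in>A. b v"] by (simp flip: sum_distrib_right add: algebra_simps)
    finally show ?thesis .
  qed
  \<comment> \<open>Treating \<open>a\<close> as not picked needs a correction only on the event
    \<open>x = Some a\<close>, where every other node takes its larger value
    \<open>b v\<close>.\<close>
  have "?q x * (\<Prod>v\<in>insert a A. if x = Some v then l v else b v)
      = b a * (?q x * ?P x) - (b a - l a) * (?q x * (if x = Some a then \<Prod>v\<in>A. b v else 0))" for x
  proof -
    have "?P x = (\<Prod>v\<in>A. b v)" if "x = Some a"
      using that insert.hyps by (intro prod.cong) auto
    then show ?thesis using insert.hyps by (auto simp: algebra_simps)
  qed
  then have "(\<Sum>x\<in>choices S. ?q x * (\<Prod>v\<in>insert a A. if x = Some v then l v else b v))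
    = b a * ?E - (b a - l a) * (\<Sum>x\<in>choices S. ?q x * (if x = Some a then \<Prod>v\<in>A. b v else 0))"
    by (simp add: sum_subtractf sum_distrib_left)
  also have "\<dots> = b a * ?E - (b a - l a) * (p a * (\<Prod>v\<in>A. b v))"
    using sum_choices_single[OF S p(2), where u = a and l = "\<Prod>v\<in>A. b v" and b = 0] by simp
  \<comment> \<open>Negative dependence enters here: the product of the \<open>b v\<close>, attained
    when \<open>a\<close> is picked, is at least the mean \<open>?E\<close>.\<close>
  also have "\<dots> \<le> b a * ?E - (b a - l a) * (p a * ?E)"
    using E_le lb p by (simp add: mult_left_mono)
  also have "\<dots> = (p a * l a + (1 - p a) * b a) * ?E" by (simp add: algebra_simps)
  also have "\<dots> \<le> (p a * l a + (1 - p a) * b a) * (\<Prod>v\<in>A. p v * l v + (1 - p v) * b v)"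
    using insert.IH lb b0 p p1 by (intro mult_left_mono add_nonneg_nonneg mult_nonneg_nonneg) (auto)
  finally show ?case using insert.hyps by simp
qed

section \<open>Expectations over independent colors\<close>

definition expect :: "'a set \<Rightarrow> ('a \<Rightarrow> nat \<Rightarrow> real) \<Rightarrow> nat \<Rightarrow> ((nat \<Rightarrow> 'a option) \<Rightarrow> real) \<Rightarrow> real" where
  "expect S p C F = (\<Sum>f\<in>PiE {..<C} (\<lambda>_. choices S). (\<Prod>c<C. pick_weight S (\<lambda>u. p u c) (f c)) * F f)"

lemma expect_add: "expect S p C (\<lambda>f. F f + G f) = expect S p C F + expect S p C G"
  by (simp add: expect_def sum.distrib distrib_left)

lemma expect_cmult: "expect S p C (\<lambda>f. k * F f) = k * expect S p C F"
  by (simp add: expect_def sum_distrib_left mult_ac)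

lemma expect_sum: "expect S p C (\<lambda>f. \<Sum>i\<in>I. F i f) = (\<Sum>i\<in>I. expect S p C (F i))"
  unfolding expect_def sum_distrib_left by (rule sum.swap)

lemma expect_prod:
  assumes "finite S"
  shows "expect S p C (\<lambda>f. \<Prod>c<C. h c (f c))
    = (\<Prod>c<C. \<Sum>x\<in>choices S. pick_weight S (\<lambda>u. p u c) x * h c x)"
  unfolding expect_def
  by (subst prod_sum_PiE) (auto simp: finite_choices assms prod.distrib)

lemma expect_const:
  assumes "finite S"
  shows "expect S p C (\<lambda>_. k) = k"
proof -
  have "expect S p C (\<lambda>_. 1) = 1"
    using expect_prod[OF assms, of p C "\<lambda>_ _. 1"] sum_choices[OF assms, of _ "\<lambda>_. 1"] by simp
  then show ?thesis using expect_cmult[of S p C k "\<lambda>_. 1"] by simp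
qed

text \<open>Dividing the surviving weight by its survival probability compensates for the reset to 0
  and keeps the mean at \<open>y u c\<close>.\<close>

definition upd :: "('a \<Rightarrow> nat \<Rightarrow> real) \<Rightarrow> ('a \<Rightarrow> nat \<Rightarrow> real) \<Rightarrow> (nat \<Rightarrow> 'a option) \<Rightarrow> 'a \<Rightarrow> nat \<Rightarrow> real" where
  "upd p y f u c = (if f c = Some u then 0 else y u c / (1 - p u c))"

locale color_step =
  fixes S :: "'a set" and p :: "'a \<Rightarrow> nat \<Rightarrow> real" and C :: nat
  assumes fin: "finite S" and p0: "0 \<le> p u c" and p1: "p u c < 1"
    and pS: "u \<notin> S \<Longrightarrow> p u c = 0" and psum: "(\<Sum>u\<in>S. p u c) \<le> 1"
begin

abbreviation "Expect \<equiv> expect S p C"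

text \<open>Method of conditional expectations: if every outcome of positive weight exceeded
  \<open>b\<close>, so would the mean. Positive weight also rules out picks of probability
  0.\<close>

lemma expect_attained:
  assumes "Expect F \<le> b"
  obtains f where "F f \<le> b" "\<And>c u. c < C \<Longrightarrow> f c = Some u \<Longrightarrow> 0 < p u c"
proof -
  let ?w = "\<lambda>f. \<Prod>c<C. pick_weight S (\<lambda>u. p u c) (f c)"
  let ?O = "PiE {..<C} (\<lambda>_. choices S)"
  have w0: "0 \<le> ?w f" for f
    by (intro prod_nonneg pick_weight_nonneg p0 psum ballI)
  have fO: "finite ?O" by (simp add: finite_PiE finite_choices fin)
  have "\<exists>f\<in>?O. ?w f \<noteq> 0 \<and> F f \<le> b"
  proof (rule ccontr)
    assume neg: "\<not> ?thesis"
    have w1: "(\<Sum>f\<in>?O. ?w f) = 1" using expect_const[OF fin, of p C 1] by (simp add: expect_def)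
    then obtain g where g: "g \<in> ?O" "?w g \<noteq> 0" by (metis (no_types, lifting) sum.neutral zero_neq_one)
    have "(\<Sum>f\<in>?O. ?w f * b) < (\<Sum>f\<in>?O. ?w f * F f)"
    proof (rule sum_strict_mono_ex1[OF fO])
      show "\<forall>f\<in>?O. ?w f * b \<le> ?w f * F f"
        using neg w0 by (metis (no_types, lifting) linorder_le_cases mult_left_mono mult_zero_left)
      have "?w g * b < ?w g * F g" 
        using g neg w0[of g] by (intro mult_strict_left_mono) (metis not_le, metis less_le)
      then show "\<exists>f\<in>?O. ?w f * b < ?w f * F f" using g by blast
    qed
    then show False using assms w1 by (simp add: expect_def flip: sum_distrib_right)
  qed
  then obtain f where f: "?w f \<noteq> 0" "F f \<le> b" by blast
  show thesis
  proof (rule that[OF f(2)])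
    fix c u assume "c < C" "f c = Some u"
    from f(1) \<open>c < C\<close> have "pick_weight S (\<lambda>u. p u c) (f c) \<noteq> 0" by simp
    with \<open>f c = Some u\<close> show "0 < p u c" using p0[of u c] by (simp add: pick_weight_def)
  qed
qed

text \<open>Independence factors the mean over the colors, and negative dependence bounds each
  factor. The identity \<open>p * 1 + (1 - p) * (1 + \<theta> * y / (1 - p)) = 1 + \<theta> *
  y\<close> then returns the old weights.\<close>

lemma expect_load:
  assumes A: "finite A" and "0 \<le> K" "0 \<le> \<theta>" and y: "\<And>u c. 0 \<le> y u c"
  shows "Expect (\<lambda>f. \<Prod>c<C. 1 + K * (\<Prod>u\<in>A. 1 + \<theta> * upd p y f u c))
    \<le> (\<Prod>c<C. 1 + K * (\<Prod>u\<in>A. 1 + \<theta> * y u c))"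
proof -
  let ?b = "\<lambda>c u. 1 + \<theta> * (y u c / (1 - p u c))"
  let ?h = "\<lambda>c x. \<Prod>u\<in>A. if x = Some u then 1 else ?b c u"
  have b: "1 \<le> ?b c u" for c u using assms p1[of u c] by simp
  have e: "1 + \<theta> * upd p y f u c = (if f c = Some u then 1 else ?b c u)" for f u c
    by (simp add: upd_def)
  have "Expect (\<lambda>f. \<Prod>c<C. 1 + K * (\<Prod>u\<in>A. 1 + \<theta> * upd p y f u c))
      = (\<Prod>c<C. \<Sum>x\<in>choices S. pick_weight S (\<lambda>u. p u c) x * (1 + K * ?h c x))"
    unfolding e using expect_prod[OF fin, of p C "\<lambda>c x. 1 + K * ?h c x"] by simp
  also have "\<dots> \<le> (\<Prod>c<C. 1 + K * (\<Prod>u\<in>A. 1 + \<theta> * y u c))"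
  proof (intro prod_mono conjI)
    fix c
    have hn: "0 \<le> ?h c x" for x using b order.trans[OF zero_le_one] by (intro prod_nonneg) auto
    show "0 \<le> (\<Sum>x\<in>choices S. pick_weight S (\<lambda>u. p u c) x * (1 + K * ?h c x))"
      using hn assms by (intro sum_nonneg mult_nonneg_nonneg pick_weight_nonneg p0 psum add_nonneg_nonneg) auto
    have "(\<Sum>x\<in>choices S. pick_weight S (\<lambda>u. p u c) x * (1 + K * ?h c x))
       = (\<Sum>x\<in>choices S. pick_weight S (\<lambda>u. p u c) x * 1)
         + K * (\<Sum>x\<in>choices S. pick_weight S (\<lambda>u. p u c) x * ?h c x)"
      by (simp add: sum.distrib sum_distrib_left algebra_simps)
    also have "\<dots> = 1 + K * (\<Sum>x\<in>choices S. pick_weight S (\<lambda>u. p u c) x * ?h c x)"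
      by (subst sum_choices[OF fin]) simp
    also have "\<dots> \<le> 1 + K * (\<Prod>u\<in>A. p u c * 1 + (1 - p u c) * ?b c u)"
      using b by (intro add_left_mono mult_left_mono sum_choices_prod_le fin p0 pS psum A \<open>0 \<le> K\<close>) auto
    also have "(\<Prod>u\<in>A. p u c * 1 + (1 - p u c) * ?b c u) = (\<Prod>u\<in>A. 1 + \<theta> * y u c)"
      using p1 by (intro prod.cong refl) (simp add: field_simps less_imp_neq[symmetric])
    finally show "(\<Sum>x\<in>choices S. pick_weight S (\<lambda>u. p u c) x * (1 + K * ?h c x))
      \<le> 1 + K * (\<Prod>u\<in>A. 1 + \<theta> * y u c)" .
  qed
  finally show ?thesis .
qed

lemma expect_hazard:
  "Expect (\<lambda>f. \<Prod>c<C. 1 - \<phi> * upd p y f u c) = (\<Prod>c<C. 1 - \<phi> * y u c)"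
proof -
  let ?b = "\<lambda>c. 1 - \<phi> * (y u c / (1 - p u c))"
  have e: "1 - \<phi> * upd p y f u c = (if f c = Some u then 1 else ?b c)" for f c
    by (simp add: upd_def)
  have "Expect (\<lambda>f. \<Prod>c<C. 1 - \<phi> * upd p y f u c)
    = (\<Prod>c<C. \<Sum>x\<in>choices S. pick_weight S (\<lambda>u. p u c) x * (if x = Some u then 1 else ?b c))"
    unfolding e using expect_prod[OF fin, of p C "\<lambda>c x. if x = Some u then 1 else ?b c"] by simp
  also have "\<dots> = (\<Prod>c<C. p u c * 1 + (1 - p u c) * ?b c)"
    by (intro prod.cong refl sum_choices_single fin pS)
  also have "\<dots> = (\<Prod>c<C. 1 - \<phi> * y u c)"
    using p1 by (intro prod.cong refl) (simp add: field_simps less_imp_neq[symmetric])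
  finally show ?thesis .
qed

definition missed :: "(nat \<Rightarrow> 'a option) \<Rightarrow> 'a set" where
  "missed f = {u. \<forall>c<C. f c \<noteq> Some u}"

lemma expect_missed:
  "Expect (\<lambda>f. of_bool (u \<in> missed f)) = (\<Prod>c<C. 1 - p u c)"
proof -
  have e: "of_bool (u \<in> missed f) = (\<Prod>c<C. if f c = Some u then 0 else 1::real)" for f
    by (auto simp: missed_def prod_zero_iff intro!: prod.neutral[symmetric])
  show ?thesis
    unfolding e
    by (subst expect_prod[OF fin, of p C "\<lambda>c x. if x = Some u then 0 else 1"])
      (subst sum_choices_single[OF fin pS], auto)
qed

text \<open>The indicator is a product of factors 0 and 1 over colors and nodes, so the negative
  dependence bound applies with \<open>l = 0\<close> and \<open>b = 1\<close>.\<close>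

lemma expect_missed_all:
  assumes "finite A"
  shows "Expect (\<lambda>f. of_bool (A \<subseteq> missed f)) \<le> (\<Prod>u\<in>A. \<Prod>c<C. 1 - p u c)"
proof -
  let ?h = "\<lambda>x. \<Prod>u\<in>A. if x = Some u then 0 else 1::real"
  have e: "of_bool (A \<subseteq> missed f) = (\<Prod>c<C. ?h (f c))" for f
  proof (cases "A \<subseteq> missed f")
    case True
    then have "?h (f c) = 1" if "c < C" for c using that by (intro prod.neutral) (auto simp: missed_def)
    then show ?thesis using True by simp
  next
    case False
    then obtain u c where "u \<in> A" "c < C" "f c = Some u" by (auto simp: missed_def)
    then have "\<exists>c<C. ?h (f c) = 0" using assms by (auto simp: prod_zero_iff intro!: exI[of _ c])
    then show ?thesis using False by (auto simp: prod_zero_iff)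
  qed
  have "Expect (\<lambda>f. of_bool (A \<subseteq> missed f))
    = (\<Prod>c<C. \<Sum>x\<in>choices S. pick_weight S (\<lambda>u. p u c) x * ?h x)"
    unfolding e by (rule expect_prod[OF fin])
  also have "\<dots> \<le> (\<Prod>c<C. \<Prod>u\<in>A. p u c * 0 + (1 - p u c) * 1)"
    by (intro prod_mono conjI sum_choices_prod_le sum_nonneg mult_nonneg_nonneg pick_weight_nonneg
        prod_nonneg fin p0 pS psum assms) auto
  also have "\<dots> = (\<Prod>u\<in>A. \<Prod>c<C. 1 - p u c)" by (simp add: prod.swap[of _ A])
  finally show ?thesis .
qed

text \<open>Expanding the power over subsets of \<open>S\<close> leaves the events of missing a
  whole subset; once these are bounded, the sum folds back into a product over
  \<open>S\<close>.\<close>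

lemma expect_power_missed:
  assumes "0 \<le> s" and r: "\<And>u. u \<in> S \<Longrightarrow> (\<Prod>c<C. 1 - p u c) \<le> r"
  shows "Expect (\<lambda>f. (1 + s) ^ card (S \<inter> missed f)) \<le> (1 + s * r) ^ card S"
proof -
  have pow: "(\<Prod>u\<in>T. 1 + g u) = (\<Sum>A\<in>Pow T. \<Prod>u\<in>A. g u)" if "finite T" for T and g :: "'a \<Rightarrow> real"
    using prod_add[OF that, of g "\<lambda>_. 1"] by (simp add: add.commute)
  have e: "(1 + s) ^ card (S \<inter> missed f) = (\<Sum>A\<in>Pow S. s ^ card A * of_bool (A \<subseteq> missed f))" for f
  proof -
    have "(1 + s) ^ card (S \<inter> missed f) = (\<Prod>u\<in>S \<inter> missed f. 1 + s)" by simp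
    also have "\<dots> = (\<Sum>A\<in>Pow (S \<inter> missed f). s ^ card A)"
      by (subst pow) (auto simp: fin)
    also have "\<dots> = (\<Sum>A\<in>Pow S. s ^ card A * of_bool (A \<subseteq> missed f))"
      by (intro sum.mono_neutral_cong_left) (auto simp: fin)
    finally show ?thesis .
  qed
  have q0: "0 \<le> (\<Prod>c<C. 1 - p u c)" for u using p1[of u] by (intro prod_nonneg) (auto intro: less_imp_le)
  have "Expect (\<lambda>f. (1 + s) ^ card (S \<inter> missed f))
    = (\<Sum>A\<in>Pow S. s ^ card A * Expect (\<lambda>f. of_bool (A \<subseteq> missed f)))"
    unfolding e expect_sum expect_cmult ..
  also have "\<dots> \<le> (\<Sum>A\<in>Pow S. s ^ card A * (\<Prod>u\<in>A. \<Prod>c<C. 1 - p u c))"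
    using assms fin by (intro sum_mono mult_left_mono expect_missed_all) (auto intro: finite_subset)
  also have "\<dots> = (\<Prod>u\<in>S. 1 + s * (\<Prod>c<C. 1 - p u c))"
    by (subst pow) (auto simp: fin prod.distrib)
  also have "\<dots> \<le> (\<Prod>u\<in>S. 1 + s * r)"
    using assms q0 by (intro prod_mono conjI add_left_mono mult_left_mono add_nonneg_nonneg mult_nonneg_nonneg) auto
  finally show ?thesis by simp
qed

end

section \<open>Halving the degree\<close>

locale phase =
  fixes n :: nat and D :: real
  assumes n2: "2 \<le> n" and D_ge: "10 ^ 10 * ln n \<le> D"
begin

text \<open>A color is bad for an arriving node when its total load exceeds \<open>B\<close>, so that the pick
  probabilities \<open>y u c / B\<close> would not form a distribution; it is then skipped. Since
  \<open>B\<close> exceeds \<open>D\<close> by a constant factor, the weights never exceed 26 and bad colors are rare. The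
  exponents \<open>\<theta>\<close>, \<open>\<phi>\<close> and \<open>s\<close> are small enough for the second order terms of
  the three Chernoff type bounds to be harmless; \<open>r\<close> bounds the probability that a given edge
  stays uncolored.\<close>

definition C :: nat where "C = nat \<lceil>3 / 4 * D\<rceil>"
definition B :: real where "B = 26 / 25 * D"
definition \<theta> :: real where "\<theta> = 1 / 1352"
definition \<phi> :: real where "\<phi> = 1 / 10400"
definition \<phi>' :: real where "\<phi>' = 201 / 200 * \<phi>"
definition r :: real where "r = 497 / 1000"
definition s :: real where "s = 3 / 1000"

lemma ln_n: "1 / 2 \<le> ln n" "ln 2 \<le> ln (real n)"
proof -
  show "ln 2 \<le> ln (real n)" using n2 by simp
  then show "1 / 2 \<le> ln n" using ln2_ge_two_thirds by linarith
qed

lemma D_big: "10 ^ 9 \<le> D" using D_ge ln_n by simp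

lemma C_bounds: "3 / 4 * D \<le> C" "C \<le> D"
proof -
  have "real C = \<lceil>3 / 4 * D\<rceil>" using D_big by (simp add: C_def)
  moreover have "4 \<le> D" using D_big by simp
  ultimately show "3 / 4 * D \<le> C" "C \<le> D"
    using of_int_ceiling_le_add_one[of "3 / 4 * D"] le_of_int_ceiling[of "3 / 4 * D"] by linarith+
qed

lemma exp_ln_n: "exp (- 3 * ln n) \<le> 1 / 8" "exp (- 4 * ln n) \<le> 1 / 16"
proof -
  have "exp (- k * ln n) \<le> exp (- k * ln 2)" if "0 \<le> k" for k
    using ln_n that by (simp add: mult_left_mono)
  from this[of 3] this[of 4] have "exp (- 3 * ln n) \<le> exp (- 3 * ln 2)" "exp (- 4 * ln n) \<le> exp (- 4 * ln 2)"
    by linarith+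
  moreover have "exp (- 3 * ln 2) = (1 / 8 :: real)" "exp (- 4 * ln 2) = (1 / 16 :: real)"
    using exp_of_nat_mult[of 3 "ln 2 :: real"] exp_of_nat_mult[of 4 "ln 2 :: real"]
    by (simp_all add: exp_minus)
  ultimately show "exp (- 3 * ln n) \<le> 1 / 8" "exp (- 4 * ln n) \<le> 1 / 16" by linarith+
qed

lemma n_exp_le:
  assumes "4 * ln n \<le> x"
  shows "n * exp (- x) \<le> 1 / 8"
proof -
  have "n * exp (- x) \<le> exp (ln n) * exp (- 4 * ln n)"
    using assms n2 by (intro mult_mono) auto
  also have "\<dots> = exp (- 3 * ln n)" by (simp flip: exp_add)
  finally show ?thesis using exp_ln_n by linarith
qed

section \<open>Bad colors and exponential moments\<close>

definition bad :: "(nat \<Rightarrow> nat \<Rightarrow> real) \<Rightarrow> nat set \<Rightarrow> nat \<Rightarrow> bool" where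
  "bad y S c \<longleftrightarrow> B < (\<Sum>u\<in>S. y u c)"

definition rate :: "(nat \<Rightarrow> nat \<Rightarrow> real) \<Rightarrow> nat set \<Rightarrow> nat \<Rightarrow> nat \<Rightarrow> real" where
  "rate y S u c = (if u \<in> S \<and> \<not> bad y S c then y u c / B else 0)"

text \<open>For small weights a factor is about \<open>1 + exp (\<theta> * (Y - D))\<close>, where
  \<open>Y\<close> is the weight of color \<open>c\<close> on \<open>S\<close>; it is large only for
  overloaded colors.\<close>

definition load :: "(nat \<Rightarrow> nat \<Rightarrow> real) \<Rightarrow> nat set \<Rightarrow> real" where
  "load y S = (\<Prod>c<C. 1 + exp (- \<theta> * D) * (\<Prod>u\<in>S. 1 + \<theta> * y u c))"

definition family :: "nat set set" where
  "family = {S. S \<subseteq> {..<n} \<and> card S \<le> D}"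

text \<open>The normalizing exponent is the threshold \<open>D / 2600\<close> for bad colors times
  the \<open>\<theta> * D / 50\<close> that each of them contributes.\<close>

definition load_potential :: "(nat \<Rightarrow> nat \<Rightarrow> real) \<Rightarrow> real" where
  "load_potential y = exp (- (D\<^sup>2 * \<theta> / 130000)) * (\<Sum>S\<in>family. load y S)"

text \<open>An exponential moment for the lower tail of the total weight at \<open>u\<close>, with
  threshold \<open>99 / 100 * C\<close>; \<open>\<phi>'\<close> exceeds \<open>\<phi>\<close> to
  absorb the second order term of the logarithm.\<close>

definition hazard_potential :: "(nat \<Rightarrow> nat \<Rightarrow> real) \<Rightarrow> real" where
  "hazard_potential y = exp (\<phi>' * (99 / 100) * C) * (\<Sum>u<n. \<Prod>c<C. 1 - \<phi> * y u c)"

text \<open>A Chernoff moment for the uncolored degree of \<open>u\<close>, times a bound on its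
  mean growth over the at most \<open>D - deg Ss u\<close> edges still to come.\<close>

definition residue :: "nat set list \<Rightarrow> nat set list \<Rightarrow> nat \<Rightarrow> real" where
  "residue Ss Rs u = (1 + s) powr (deg Rs u - D / 2) * exp (r * s * (D - deg Ss u))"

text \<open>Each summand starts below 1/8 and exceeds 1 once one of the following happens: some set of at
  most \<open>D\<close> nodes has more than \<open>D / 2600\<close> bad colors, some node has little total weight left,
  some node has more than \<open>D / 2\<close> uncolored edges.\<close>

definition potential :: "(nat \<Rightarrow> nat \<Rightarrow> real) \<Rightarrow> nat set list \<Rightarrow> nat set list \<Rightarrow> real" where
  "potential y Ss Rs = load_potential y + hazard_potential y + (\<Sum>u<n. residue Ss Rs u)"

lemma finite_family: "finite family"
  unfolding family_def by (rule finite_subset[of _ "Pow {..<n}"]) auto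

text \<open>Every nonempty member is the image of a map from \<lfloor>D\<rfloor> positions to the
  offline nodes, with spare positions filled by a repeated element.\<close>

lemma card_family: "card family \<le> 2 * exp (D * ln n)"
proof -
  let ?m = "nat \<lfloor>D\<rfloor>"
  let ?P = "PiE {..<?m} (\<lambda>_. {..<n})"
  have "family \<subseteq> insert {} ((\<lambda>g. g ` {..<?m}) ` ?P)"
  proof
    fix S assume S: "S \<in> family"
    show "S \<in> insert {} ((\<lambda>g. g ` {..<?m}) ` ?P)"
    proof (cases "S = {}")
      case False
      have fin: "finite S" using S finite_subset unfolding family_def by blast
      have m: "card S \<le> ?m" using S unfolding family_def by (simp add: le_nat_floor)
      obtain e where e: "bij_betw e {..<card S} S" using ex_bij_betw_nat_finite[OF fin] by (auto simp: atLeast0LessThan)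
      obtain a where a: "a \<in> S" using False by blast
      define g where "g = (\<lambda>i\<in>{..<?m}. if i < card S then e i else a)"
      have "g ` {..<?m} = S"
      proof
        show "g ` {..<?m} \<subseteq> S" using e a by (auto simp: g_def bij_betw_def)
        show "S \<subseteq> g ` {..<?m}"
        proof
          fix x assume "x \<in> S"
          then obtain i where "i < card S" "x = e i" using e by (auto simp: bij_betw_def)
          then show "x \<in> g ` {..<?m}" using m by (auto simp: g_def image_iff intro!: bexI[of _ i])
        qed
      qed
      moreover have "g \<in> ?P"
        using \<open>g ` {..<?m} = S\<close> S by (auto simp: g_def family_def PiE_iff)
      ultimately show ?thesis by blast
    qed simp
  qed
  then have "card family \<le> card (insert {} ((\<lambda>g. g ` {..<?m}) ` ?P))"
    by (intro card_mono) (auto simp: finite_PiE)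
  also have "\<dots> \<le> Suc (card ((\<lambda>g. g ` {..<?m}) ` ?P))"
    by (simp add: card_insert_if finite_PiE)
  also have "\<dots> \<le> Suc (card ?P)"
    by (simp add: card_image_le finite_PiE)
  also have "card ?P = n ^ ?m" by (simp add: card_PiE)
  finally have "real (card family) \<le> 1 + real n ^ ?m" by (metis of_nat_Suc of_nat_le_iff of_nat_power add.commute)
  moreover have "real n ^ ?m \<le> exp (D * ln n)"
  proof -
    have "real n ^ ?m = exp (?m * ln n)" using n2 by (simp add: exp_of_nat_mult)
    also have "\<dots> \<le> exp (D * ln n)" using D_big ln_n by (simp add: mult_right_mono)
    finally show ?thesis .
  qed
  moreover have "1 \<le> exp (D * ln n)" using D_big ln_n by simp
  ultimately show ?thesis by linarith
qed

section \<open>Initial values of the potentials\<close>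

lemma load_potential_init: "load_potential (\<lambda>_ _. 1) \<le> 1 / 8"
proof -
  \<comment> \<open>With unit weights a set of at most \<open>D\<close> nodes has load at most
    \<open>D\<close>, so each color contributes a factor of at most 2.\<close>
  have "load (\<lambda>_ _. 1) S \<le> exp (D * ln n)" if "S \<in> family" for S
  proof -
    have "(1 + \<theta>) ^ card S \<le> exp \<theta> ^ card S"
      by (intro power_mono exp_ge_add_one_self) (simp add: \<theta>_def)
    also have "\<dots> = exp (\<theta> * card S)" by (metis exp_of_nat_mult mult.commute)
    also have "\<dots> \<le> exp (\<theta> * D)" using that by (simp add: family_def \<theta>_def)
    finally have "exp (- \<theta> * D) * (1 + \<theta>) ^ card S \<le> 1"
      by (simp add: exp_minus field_simps)
    then have "load (\<lambda>_ _. 1) S \<le> (\<Prod>c<C. 2)"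
      unfolding load_def by (intro prod_mono) (auto simp: \<theta>_def intro!: add_nonneg_nonneg)
    also have "\<dots> = exp (C * ln 2)" by (simp add: exp_of_nat_mult)
    also have "\<dots> \<le> exp (D * ln n)" using C_bounds ln_n by (simp add: mult_mono)
    finally show ?thesis .
  qed
  then have "(\<Sum>S\<in>family. load (\<lambda>_ _. 1) S) \<le> card family * exp (D * ln n)"
    by (metis sum_bounded_above)
  also have "\<dots> \<le> 2 * exp (D * ln n) * exp (D * ln n)"
    by (intro mult_right_mono card_family) simp
  also have "\<dots> = 2 * exp (2 * (D * ln n))" by (simp flip: exp_add)
  finally have "load_potential (\<lambda>_ _. 1) \<le> exp (- (D\<^sup>2 * \<theta> / 130000)) * (2 * exp (2 * (D * ln n)))"
    unfolding load_potential_def by (intro mult_left_mono) auto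
  also have "\<dots> = 2 * exp (2 * (D * ln n) - D\<^sup>2 * \<theta> / 130000)" by (simp flip: exp_add)
  \<comment> \<open>By the lower bound on \<open>D\<close>, the quadratic exponent is more than
    \<open>50 * D * ln n\<close>, against \<open>2 * D * ln n + 4 * ln n\<close>.\<close>
  also have "\<dots> \<le> 2 * exp (- 4 * ln n)"
  proof -
    have "10 ^ 10 * (D * ln n) \<le> D\<^sup>2"
      using D_ge D_big mult_left_mono[OF D_ge, of D] by (simp add: power2_eq_square mult_ac)
    moreover have "ln n \<le> D * ln n" using D_big ln_n by simp
    moreover have "0 \<le> ln (real n)" using ln_n by simp
    ultimately show ?thesis by (simp add: \<theta>_def)
  qed
  finally show ?thesis using exp_ln_n by linarith
qed

text \<open>\<open>\<phi>' * (99 / 100)\<close> is still below \<open>\<phi>\<close>, which leaves a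
  negative exponent linear in \<open>C\<close>.\<close>

lemma hazard_potential_init: "hazard_potential (\<lambda>_ _. 1) \<le> 1 / 8"
proof -
  have "(1 - \<phi>) ^ C \<le> exp (- \<phi>) ^ C"
    using exp_ge_add_one_self[of "- \<phi>"] by (intro power_mono) (auto simp: \<phi>_def)
  also have "\<dots> = exp (- \<phi> * C)" by (metis exp_of_nat_mult mult.commute)
  finally have "(1 - \<phi>) ^ C \<le> exp (- \<phi> * C)" .
  then have "hazard_potential (\<lambda>_ _. 1) \<le> exp (\<phi>' * (99 / 100) * C) * (n * exp (- \<phi> * C))"
    by (simp add: hazard_potential_def mult_left_mono)
  also have "\<dots> = n * exp (- (\<phi> * C - \<phi>' * (99 / 100) * C))"
    by (simp flip: exp_add)
  also have "\<dots> \<le> 1 / 8"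
    using C_bounds D_ge ln_n by (intro n_exp_le) (simp add: \<phi>'_def \<phi>_def)
  finally show ?thesis .
qed

text \<open>The exponent is negative because \<open>r < (1 - s) / 2\<close>. The same quantity later
  bounds the moment for the uncolored edges of an arriving node.\<close>

lemma residue_init: "n * ((1 + s) powr (- D / 2) * exp (r * s * D)) \<le> 1 / 8"
proof -
  have "s - s\<^sup>2 \<le> ln (1 + s)" by (rule ln_one_plus_pos_lower_bound) (auto simp: s_def)
  then have "r * s * D - D / 2 * ln (1 + s) \<le> r * s * D - D / 2 * (s - s\<^sup>2)"
    using D_big by (intro diff_left_mono mult_left_mono) auto
  also have "\<dots> \<le> - (4 * ln n)"
    using D_ge D_big ln_n by (simp add: r_def s_def power2_eq_square)
  finally have le: "4 * ln n \<le> - (r * s * D - D / 2 * ln (1 + s))" by simp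
  have "(1 + s) powr (- D / 2) * exp (r * s * D) = exp (- (- (r * s * D - D / 2 * ln (1 + s))))"
    by (simp add: powr_def s_def flip: exp_add)
  then show ?thesis using n_exp_le[OF le] by (simp only:)
qed

text \<open>The weight \<open>y u c\<close> is 0 once \<open>u\<close> was picked by \<open>c\<close>. Before that its inverse, the
  probability that \<open>u\<close> was not picked so far, drops by \<open>1 / B\<close> with each arriving neighbor
  for which \<open>c\<close> is not bad.\<close>

definition valid :: "(nat \<Rightarrow> nat \<Rightarrow> real) \<Rightarrow> nat set list \<Rightarrow> bool" where
  "valid y Ss \<longleftrightarrow> (\<forall>u c. 0 \<le> y u c \<and> y u c * (1 - deg Ss u / B) \<le> 1)"

lemma valid_le:
  assumes "valid y Ss" "legal n D Ss"
  shows "0 \<le> y u c" "y u c \<le> 26"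
proof -
  show y0: "0 \<le> y u c" using assms(1) by (simp add: valid_def)
  have "real (deg Ss u) \<le> D" using assms(2) by (simp add: legal_def)
  \<comment> \<open>The bound 26 comes from \<open>D / B = 25 / 26\<close>.\<close>
  then have "1 / 26 \<le> 1 - deg Ss u / B" using D_big by (simp add: B_def field_simps)
  then have "y u c * (1 / 26) \<le> y u c * (1 - deg Ss u / B)" using y0 by (rule mult_left_mono)
  also have "\<dots> \<le> 1" using assms(1) by (simp add: valid_def)
  finally show "y u c \<le> 26" by simp
qed

lemma load_nonneg: "(\<And>u c. 0 \<le> y u c) \<Longrightarrow> 0 \<le> load y S"
  unfolding load_def by (intro prod_nonneg ballI add_nonneg_nonneg mult_nonneg_nonneg) (auto simp: \<theta>_def)

lemma load_potential_nonneg: "(\<And>u c. 0 \<le> y u c) \<Longrightarrow> 0 \<le> load_potential y"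
  unfolding load_potential_def by (intro mult_nonneg_nonneg sum_nonneg load_nonneg) auto

lemma hazard_factor_nonneg:
  assumes "\<And>u c. 0 \<le> y u c" "\<And>u c. y u c \<le> 26"
  shows "0 \<le> (\<Prod>c<C. 1 - \<phi> * y u c)"
proof (intro prod_nonneg ballI)
  fix c
  show "0 \<le> 1 - \<phi> * y u c" using assms(2)[of u c] by (simp add: \<phi>_def)
qed

lemma hazard_potential_nonneg:
  "(\<And>u c. 0 \<le> y u c) \<Longrightarrow> (\<And>u c. y u c \<le> 26) \<Longrightarrow> 0 \<le> hazard_potential y"
  unfolding hazard_potential_def by (intro mult_nonneg_nonneg sum_nonneg hazard_factor_nonneg) auto

lemma residue_nonneg: "0 \<le> residue Ss Rs u"
  by (simp add: residue_def)

section \<open>Consequences of a small potential\<close>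

lemma few_bad_colors:
  assumes y: "\<And>u c. 0 \<le> y u c" "\<And>u c. y u c \<le> 26" and P: "load_potential y < 1" and S: "S \<in> family"
  shows "card {c. c < C \<and> bad y S c} \<le> D / 2600"
proof (rule ccontr)
  assume many: "\<not> ?thesis"
  let ?K = "{c. c < C \<and> bad y S c}"
  let ?X = "\<lambda>c. exp (- \<theta> * D) * (\<Prod>u\<in>S. 1 + \<theta> * y u c)"
  have X0: "0 \<le> ?X c" for c using y by (intro mult_nonneg_nonneg prod_nonneg) (auto simp: \<theta>_def)
  \<comment> \<open>The surplus 1/50 is \<open>51 / 52 * (26 / 25) - 1\<close>: the factor
    \<open>51 / 52\<close> pays for the second order term, and \<open>26 / 25\<close> is
    \<open>B / D\<close>. More than \<open>D / 2600\<close> such factors would push the potential to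
    at least 1.\<close>
  have X: "exp (\<theta> * D / 50) \<le> ?X c" if "bad y S c" for c
  proof -
    have one: "exp (\<theta> * (51 / 52) * y u c) \<le> 1 + \<theta> * y u c" for u
    proof -
      let ?x = "\<theta> * y u c"
      have x: "0 \<le> ?x" "?x \<le> 1 / 52" using y(1,2)[of u c] by (auto simp: \<theta>_def)
      then have "?x - ?x\<^sup>2 \<le> ln (1 + ?x)" by (intro ln_one_plus_pos_lower_bound) auto
      moreover have "?x * ?x \<le> ?x * (1 / 52)" using x by (intro mult_left_mono)
      ultimately have "\<theta> * (51 / 52) * y u c \<le> ln (1 + ?x)" by (simp add: power2_eq_square)
      then have "exp (\<theta> * (51 / 52) * y u c) \<le> exp (ln (1 + ?x))" by (simp only: exp_le_cancel_iff)
      also have "\<dots> = 1 + ?x" using x by simp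
      finally show ?thesis .
    qed
    have "\<theta> * D / 50 = - \<theta> * D + \<theta> * (51 / 52) * B" by (simp add: B_def)
    also have "\<dots> \<le> - \<theta> * D + \<theta> * (51 / 52) * (\<Sum>u\<in>S. y u c)"
      using that by (simp add: bad_def \<theta>_def)
    finally have "exp (\<theta> * D / 50) \<le> exp (- \<theta> * D) * exp (\<theta> * (51 / 52) * (\<Sum>u\<in>S. y u c))"
      by (simp flip: exp_add)
    also have "exp (\<theta> * (51 / 52) * (\<Sum>u\<in>S. y u c)) = (\<Prod>u\<in>S. exp (\<theta> * (51 / 52) * y u c))"
      using S finite_subset[of S "{..<n}"] by (simp add: sum_distrib_left exp_sum family_def)
    also have "exp (- \<theta> * D) * \<dots> \<le> ?X c"
      using one by (intro mult_left_mono prod_mono) auto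
    finally show ?thesis .
  qed
  have "exp (D\<^sup>2 * \<theta> / 130000) \<le> exp (card ?K * (\<theta> * D / 50))"
  proof -
    have "D / 2600 * (\<theta> * D / 50) \<le> card ?K * (\<theta> * D / 50)"
      using many D_big by (intro mult_right_mono) (auto simp: \<theta>_def)
    then show ?thesis by (simp add: power2_eq_square mult_ac)
  qed
  also have "\<dots> = (\<Prod>c\<in>?K. exp (\<theta> * D / 50))" by (simp only: exp_of_nat_mult prod_constant)
  also have "\<dots> \<le> (\<Prod>c\<in>?K. 1 + ?X c)" using X by (intro prod_mono) (auto simp: add_increasing)
  also have "\<dots> \<le> load y S"
    unfolding load_def using X0 by (intro prod_mono2) (auto simp: add_nonneg_nonneg)
  also have "\<dots> \<le> (\<Sum>S\<in>family. load y S)"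
    by (intro member_le_sum S finite_family load_nonneg y)
  finally have "exp (- (D\<^sup>2 * \<theta> / 130000)) * exp (D\<^sup>2 * \<theta> / 130000) \<le> load_potential y"
    unfolding load_potential_def by (intro mult_left_mono) auto
  then show False using P by (simp flip: exp_add)
qed

text \<open>A total weight below the threshold would make the product at \<open>u\<close> at least
  \<open>exp (- (\<phi>' * (99 / 100) * C))\<close>, and hence the potential at least 1.\<close>

lemma many_colors:
  assumes y: "\<And>u c. 0 \<le> y u c" "\<And>u c. y u c \<le> 26" and P: "hazard_potential y < 1" and u: "u < n"
  shows "99 / 100 * C \<le> (\<Sum>c<C. y u c)"
proof (rule ccontr)
  assume few: "\<not> ?thesis"
  have one: "exp (- \<phi>' * y u c) \<le> 1 - \<phi> * y u c" for c
  proof -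
    let ?x = "\<phi> * y u c"
    have x: "0 \<le> ?x" "?x \<le> 1 / 400" using y(1,2)[of u c] by (auto simp: \<phi>_def)
    then have "- ?x - 2 * ?x\<^sup>2 \<le> ln (1 - ?x)" by (intro ln_one_minus_pos_lower_bound) auto
    moreover have "?x * ?x \<le> ?x * (1 / 400)" using x by (intro mult_left_mono)
    ultimately have "- \<phi>' * y u c \<le> ln (1 - ?x)" by (simp add: power2_eq_square \<phi>'_def)
    then show ?thesis using x by (simp add: ln_ge_iff)
  qed
  have "exp (- (\<phi>' * (99 / 100) * C)) \<le> exp (- \<phi>' * (\<Sum>c<C. y u c))"
    using few by (simp add: \<phi>'_def \<phi>_def)
  also have "\<dots> = (\<Prod>c<C. exp (- \<phi>' * y u c))" by (simp add: sum_distrib_left exp_sum flip: sum_negf)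
  also have "\<dots> \<le> (\<Prod>c<C. 1 - \<phi> * y u c)" using one by (intro prod_mono) auto
  also have "\<dots> \<le> (\<Sum>u<n. \<Prod>c<C. 1 - \<phi> * y u c)"
    using u by (intro member_le_sum hazard_factor_nonneg y) auto
  finally have "exp (\<phi>' * (99 / 100) * C) * exp (- (\<phi>' * (99 / 100) * C)) \<le> hazard_potential y"
    unfolding hazard_potential_def by (intro mult_left_mono) auto
  then show False using P by (simp flip: exp_add)
qed

text \<open>Bad colors take at most \<open>26 * (D / 2600) = D / 100\<close> from the weight of
  \<open>u\<close>. The rest divided by \<open>B\<close> is a total rate of at least 0.7043,
  slightly above \<open>ln 2\<close>, so the edge is missed with probability below 1/2.\<close>

lemma miss_probability:
  assumes y: "\<And>u c. 0 \<le> y u c" "\<And>u c. y u c \<le> 26"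
    and P: "load_potential y < 1" "hazard_potential y < 1" and S: "S \<in> family" and u: "u \<in> S"
  shows "(\<Prod>c<C. 1 - rate y S u c) \<le> r"
proof -
  let ?K = "{c. c < C \<and> bad y S c}"
  have un: "u < n" using S u by (auto simp: family_def)
  have B0: "0 < B" using D_big by (simp add: B_def)
  have "(\<Sum>c<C. y u c) \<le> (\<Sum>c<C. B * rate y S u c) + (\<Sum>c<C. if bad y S c then 26 else 0)"
    unfolding sum.distrib[symmetric]
    using y B0 u by (intro sum_mono) (auto simp: rate_def)
  also have "(\<Sum>c<C. if bad y S c then 26 else 0) = 26 * real (card ?K)"
    by (subst sum.inter_filter[symmetric]) (auto simp: lessThan_def conj_commute)
  also have "\<dots> \<le> D / 100" using few_bad_colors[OF y P(1) S] by simp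
  finally have "99 / 100 * (3 / 4 * D) - D / 100 \<le> B * (\<Sum>c<C. rate y S u c)"
    using many_colors[OF y P(2) un] C_bounds by (simp add: sum_distrib_left)
  then have "B * (7043 / 10000) \<le> B * (\<Sum>c<C. rate y S u c)"
    using D_big by (simp add: B_def)
  then have rate: "7043 / 10000 \<le> (\<Sum>c<C. rate y S u c)" using B0 by simp
  have r1: "rate y S u c \<le> 1" for c using y(2)[of u c] D_big by (auto simp: rate_def B_def field_simps)
  have "(\<Prod>c<C. 1 - rate y S u c) \<le> (\<Prod>c<C. exp (- rate y S u c))"
    using r1 exp_ge_add_one_self[of "- rate y S u c" for c] by (intro prod_mono) auto
  also have "\<dots> = exp (- (\<Sum>c<C. rate y S u c))" by (simp add: exp_sum flip: sum_negf)
  also have "\<dots> \<le> exp (- (7043 / 10000))" using rate by simp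
  also have "\<dots> \<le> r"
  proof -
    \<comment> \<open>Expanding around \<open>ln 2\<close> makes the linear bound on
      \<open>exp\<close> sharp enough.\<close>
    have "1 + (7043 / 10000 - ln 2) \<le> exp (7043 / 10000 - ln 2 :: real)" by (rule exp_ge_add_one_self)
    also have "\<dots> = exp (7043 / 10000) / 2" by (simp add: exp_diff)
    finally show ?thesis using ln2_le_25_over_36 by (simp add: exp_minus r_def field_simps)
  qed
  finally show ?thesis .
qed

section \<open>Processing one arrival\<close>

lemma color_step_rate:
  assumes y: "\<And>u c. 0 \<le> y u c" "\<And>u c. y u c \<le> 26" and S: "finite S"
  shows "color_step S (rate y S)"
proof
  fix u c
  have B0: "26 < B" using D_big by (simp add: B_def)
  show "0 \<le> rate y S u c" using y B0 by (simp add: rate_def)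
  show "rate y S u c < 1" using y(2)[of u c] B0 by (simp add: rate_def)
  show "rate y S u c = 0" if "u \<notin> S" using that by (simp add: rate_def)
  show "(\<Sum>u\<in>S. rate y S u c) \<le> 1"
  proof (cases "bad y S c")
    case False
    then have "(\<Sum>u\<in>S. rate y S u c) = (\<Sum>u\<in>S. y u c) / B"
      unfolding sum_divide_distrib by (intro sum.cong) (auto simp: rate_def)
    then show ?thesis using False B0 by (simp add: bad_def)
  qed (simp add: rate_def)
qed (fact S)

lemma valid_upd:
  assumes "valid y Ss" "legal n D Ss"
  shows "valid (upd (rate y S) y f) (Ss @ [S])"
  unfolding valid_def
proof (intro allI)
  fix u c
  let ?p = "rate y S u c" and ?d = "1 - deg Ss u / B"
  have B0: "26 < B" using D_big by (simp add: B_def)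
  note y = valid_le[OF assms, of u c]
  have v: "y u c * ?d \<le> 1" using assms(1) by (simp add: valid_def)
  have p: "0 \<le> ?p" "?p < 1" using y B0 by (auto simp: rate_def)
  show "0 \<le> upd (rate y S) y f u c \<and> upd (rate y S) y f u c * (1 - deg (Ss @ [S]) u / B) \<le> 1"
  proof (cases "f c = Some u")
    case False
    have d: "1 - deg (Ss @ [S]) u / B = ?d - of_bool (u \<in> S) / B"
      by (simp add: add_divide_distrib)
    \<comment> \<open>If \<open>u\<close> is in \<open>S\<close> and \<open>c\<close> is not bad,
      the arrival lowers the left side by exactly \<open>?p\<close>; division by
      \<open>1 - ?p\<close> then restores the bound 1.\<close>
    have "y u c * (?d - of_bool (u \<in> S) / B) \<le> 1 - ?p"
    proof (cases "u \<in> S \<and> \<not> bad y S c")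
      case True
      then show ?thesis using v by (simp add: rate_def algebra_simps)
    next
      case False
      then have "?p = 0" by (auto simp: rate_def)
      moreover have "y u c * (?d - of_bool (u \<in> S) / B) \<le> y u c * ?d"
        using y B0 by (intro mult_left_mono) auto
      ultimately show ?thesis using v by simp
    qed
    then show ?thesis using False y p unfolding d by (simp add: upd_def divide_le_eq)
  qed (simp add: upd_def)
qed

text \<open>The summands of the potential are supermartingales, and the moment for the uncolored
  edges of the arriving node has mean at most \<open>1 / (8 * n)\<close>. Some outcome keeps their
  sum at or below the bound on its mean.\<close>

lemma potential_step:
  assumes y: "\<And>u c. 0 \<le> y u c" "\<And>u c. y u c \<le> 26" and P: "potential y Ss Rs < 1"
    and S: "S \<in> family"
  obtains f where
    "potential (upd (rate y S) y f) (Ss @ [S]) (Rs @ [S \<inter> color_step.missed C f])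
       + (1 + s) powr (card (S \<inter> color_step.missed C f) - D / 2) \<le> potential y Ss Rs + 1 / (8 * n)"
    "\<And>c u. c < C \<Longrightarrow> f c = Some u \<Longrightarrow> 0 < rate y S u c"
proof -
  have fS: "finite S" using S finite_subset unfolding family_def by blast
  interpret color_step S "rate y S" C by (intro color_step_rate y fS)
  have nn: "0 \<le> load_potential y" "0 \<le> hazard_potential y" "0 \<le> (\<Sum>u<n. residue Ss Rs u)"
    by (intro load_potential_nonneg hazard_potential_nonneg sum_nonneg residue_nonneg y)+
  then have "load_potential y < 1" "hazard_potential y < 1"
    using P unfolding potential_def by linarith+
  then have miss: "(\<Prod>c<C. 1 - rate y S u c) \<le> r" if "u \<in> S" for u
    using that by (intro miss_probability y S)
  define \<psi> where "\<psi> f = upd (rate y S) y f" for f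
  have L: "Expect (\<lambda>f. load_potential (\<psi> f)) \<le> load_potential y"
    unfolding load_potential_def expect_cmult expect_sum load_def \<psi>_def
    by (intro mult_left_mono sum_mono expect_load y) (auto simp: \<theta>_def family_def intro: finite_subset)
  have H: "Expect (\<lambda>f. hazard_potential (\<psi> f)) \<le> hazard_potential y"
    unfolding hazard_potential_def expect_cmult expect_sum \<psi>_def expect_hazard ..
  have s0: "0 < s" by (simp add: s_def)
  have sr: "1 + s * r \<le> exp (r * s)" using exp_ge_add_one_self[of "r * s"] by (simp add: mult.commute)
  \<comment> \<open>An edge at \<open>u\<close> multiplies the residue by
    \<open>exp (- (r * s))\<close> and, if missed, also by \<open>1 + s\<close>; the mean factor is
    at most \<open>exp (- (r * s)) * (1 + s * r)\<close>, hence at most 1.\<close>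
  have R: "Expect (\<lambda>f. residue (Ss @ [S]) (Rs @ [S \<inter> missed f]) u) \<le> residue Ss Rs u" for u
  proof (cases "u \<in> S")
    case True
    have "residue (Ss @ [S]) (Rs @ [S \<inter> missed f]) u
      = (residue Ss Rs u * exp (- (r * s))) * (1 + s * of_bool (u \<in> missed f))" for f
    proof -
      have "exp (r * s * (D - (deg Ss u + 1))) = exp (r * s * (D - deg Ss u)) * exp (- (r * s))"
        by (simp add: algebra_simps flip: exp_add)
      moreover have "(1 + s) powr (deg Rs u + 1 - D / 2) = (1 + s) powr (deg Rs u - D / 2) * (1 + s)"
        using s0 powr_add[of "1 + s" "deg Rs u - D / 2" 1] by (simp add: algebra_simps)
      ultimately show ?thesis using True by (simp add: residue_def add.commute)
    qed
    then have "Expect (\<lambda>f. residue (Ss @ [S]) (Rs @ [S \<inter> missed f]) u)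
      = (residue Ss Rs u * exp (- (r * s))) * (1 + s * (\<Prod>c<C. 1 - rate y S u c))"
      by (simp only: expect_cmult expect_add expect_const[OF fin] expect_missed)
    also have "\<dots> \<le> (residue Ss Rs u * exp (- (r * s))) * (1 + s * r)"
      using miss[OF True] s0 residue_nonneg by (intro mult_left_mono add_left_mono) auto
    also have "\<dots> \<le> (residue Ss Rs u * exp (- (r * s))) * exp (r * s)"
      using sr residue_nonneg by (intro mult_left_mono) auto
    finally show ?thesis by (simp add: mult.assoc flip: exp_add)
  next
    case False
    then show ?thesis by (simp add: residue_def expect_const[OF fin])
  qed
  have card: "Expect (\<lambda>f. (1 + s) powr (card (S \<inter> missed f) - D / 2)) \<le> 1 / (8 * n)"
  proof -
    have e: "(1 + s) powr (card (S \<inter> missed f) - D / 2) = (1 + s) powr (- D / 2) * (1 + s) ^ card (S \<inter> missed f)" for f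
      using s0 powr_add[of "1 + s" "- D / 2" "card (S \<inter> missed f)"] by (simp add: powr_realpow)
    have "Expect (\<lambda>f. (1 + s) ^ card (S \<inter> missed f)) \<le> (1 + s * r) ^ card S"
      using miss s0 by (intro expect_power_missed) auto
    also have "\<dots> \<le> exp (r * s) ^ card S" using sr by (intro power_mono) (auto simp: s_def r_def)
    also have "\<dots> = exp (card S * (r * s))" by (simp add: exp_of_nat_mult)
    also have "\<dots> \<le> exp (D * (r * s))" using S by (simp add: family_def r_def s_def)
    finally have "Expect (\<lambda>f. (1 + s) powr (card (S \<inter> missed f) - D / 2))
      \<le> (1 + s) powr (- D / 2) * exp (r * s * D)"
      unfolding e expect_cmult by (intro mult_left_mono) (auto simp: mult_ac)
    also have "\<dots> \<le> 1 / (8 * n)" using residue_init n2 by (simp add: field_simps)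
    finally show ?thesis .
  qed
  have "Expect (\<lambda>f. potential (\<psi> f) (Ss @ [S]) (Rs @ [S \<inter> missed f]) + (1 + s) powr (card (S \<inter> missed f) - D / 2))
    \<le> potential y Ss Rs + 1 / (8 * n)"
    unfolding potential_def expect_add expect_sum
    by (intro add_mono sum_mono L H R card)
  from expect_attained[OF this] show thesis using that unfolding \<psi>_def by blast
qed

lemma reducible_half: "reducible n D C (D / 2)"
proof -
  \<comment> \<open>The potential starts at no more than 3/8 and its bound grows by
    \<open>1 / (8 * n)\<close> per arrival, hence never exceeds 1/2. A used color has weight 0 and
    so rate 0, which prevents a second use at the same node.\<close>
  define Inv where "Inv g \<longleftrightarrow> (\<exists>y. valid y (map fst g) \<and> legal n (D / 2) (map left g)
    \<and> (\<forall>(S, f)\<in>set g. \<forall>u c. f u = Some c \<longrightarrow> y u c = 0)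
    \<and> potential y (map fst g) (map left g) \<le> 3 / 8 + length g / (8 * n))"
    for g :: "(nat set \<times> (nat \<Rightarrow> nat option)) list"
  have "Inv []"
  proof -
    have "potential (\<lambda>_ _. 1) [] [] \<le> 3 / 8"
      using load_potential_init hazard_potential_init residue_init
      by (simp add: potential_def residue_def)
    moreover have "legal n (D / 2) []" using D_big by (simp add: legal_def)
    ultimately show ?thesis unfolding Inv_def by (intro exI[of _ "\<lambda>_ _. 1"]) (simp add: valid_def)
  qed
  moreover have "\<exists>f. extends n (D / 2) C g S f \<and> Inv (g @ [(S, f)])"
    if "Inv g" and L: "legal n D (map fst g @ [S])" for g S
  proof -
    let ?Ss = "map fst g" and ?Rs = "map left g"
    note L' = legal_snocD[OF L]
    obtain y where v: "valid y ?Ss" and lR: "legal n (D / 2) ?Rs"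
      and used: "\<And>S f u c. (S, f) \<in> set g \<Longrightarrow> f u = Some c \<Longrightarrow> y u c = 0"
      and P: "potential y ?Ss ?Rs \<le> 3 / 8 + length g / (8 * n)"
      using \<open>Inv g\<close> unfolding Inv_def by blast
    note y = valid_le[OF v L'(1)]
    have len: "length g < n" using L'(2) by simp
    then have len': "length g / (8 * n) + 1 / (8 * n) \<le> 1 / 8" using n2 by (simp add: field_simps)
    have S: "S \<in> family" using L' by (simp add: family_def)
    have "0 \<le> 1 / (8 * real n)" by simp
    with P len' have "potential y ?Ss ?Rs < 1" by linarith
    from potential_step[OF y this S] obtain k where
      k: "potential (upd (rate y S) y k) (?Ss @ [S]) (?Rs @ [S \<inter> color_step.missed C k])
       + (1 + s) powr (card (S \<inter> color_step.missed C k) - D / 2) \<le> potential y ?Ss ?Rs + 1 / (8 * n)"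
      and pos: "\<And>c u. c < C \<Longrightarrow> k c = Some u \<Longrightarrow> 0 < rate y S u c" by blast
    interpret color_step S "rate y S" C by (intro color_step_rate y L'(4))
    let ?y = "upd (rate y S) y k" and ?R = "S \<inter> missed k"
    have v': "valid ?y (?Ss @ [S])" by (rule valid_upd[OF v L'(1)])
    note y' = valid_le[OF v' L]
    \<comment> \<open>A node picked by several colors keeps an arbitrary one of them. Since a color
      picks at most one node, \<open>f\<close> is injective.\<close>
    define f where "f u = (if u \<in> missed k then None else Some (SOME c. c < C \<and> k c = Some u))" for u
    have f: "c < C" "k c = Some u" if "f u = Some c" for u c
    proof -
      have "\<exists>c. c < C \<and> k c = Some u" using that by (auto simp: f_def missed_def split: if_splits)
      from someI_ex[OF this] show "c < C" "k c = Some u" using that by (auto simp: f_def split: if_splits)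
    qed
    have rate_pos: "u \<in> S" "0 < y u c" if "f u = Some c" for u c
      using pos[OF f[OF that]] y(1)[of u c] by (auto simp: rate_def less_le split: if_splits)
    have domf: "dom f \<subseteq> S" using rate_pos(1) by blast
    have leftf: "left (S, f) = ?R" by (auto simp: left_def f_def)
    let ?P = "potential ?y (?Ss @ [S]) (?Rs @ [?R])"
    have nn: "0 \<le> load_potential ?y" "0 \<le> hazard_potential ?y"
      by (intro load_potential_nonneg hazard_potential_nonneg y')+
    have P': "?P + (1 + s) powr (card ?R - D / 2) < 1" "?P \<le> 3 / 8 + (length g + 1) / (8 * n)"
    proof -
      show "?P + (1 + s) powr (card ?R - D / 2) < 1" using k P len' by linarith
      have "0 \<le> (1 + s) powr (card ?R - D / 2)" by simp
      with k P show "?P \<le> 3 / 8 + (length g + 1) / (8 * n)"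
        unfolding of_nat_add of_nat_1 add_divide_distrib by linarith
    qed
    have powr_ge: "x < D / 2" if "(1 + s) powr (x - D / 2) < 1" for x
    proof (rule ccontr)
      assume "\<not> x < D / 2"
      then have "1 \<le> (1 + s) powr (x - D / 2)" by (intro ge_one_powr_ge_zero) (auto simp: s_def)
      then show False using that by simp
    qed
    have degR: "deg (?Rs @ [?R]) u \<le> D / 2" for u
    proof (cases "u < n")
      case True
      have "residue (?Ss @ [S]) (?Rs @ [?R]) u \<le> (\<Sum>u<n. residue (?Ss @ [S]) (?Rs @ [?R]) u)"
        using True by (intro member_le_sum residue_nonneg) auto
      also have "\<dots> < 1"
      proof -
        have "0 \<le> (1 + s) powr (card ?R - D / 2)" by simp
        then show ?thesis using P'(1) nn unfolding potential_def by linarith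
      qed
      finally have lt: "residue (?Ss @ [S]) (?Rs @ [?R]) u < 1" .
      have "deg (?Ss @ [S]) u \<le> D" using L by (simp add: legal_def)
      then have "1 \<le> exp (r * s * (D - deg (?Ss @ [S]) u))" by (simp add: r_def s_def)
      then have "(1 + s) powr (deg (?Rs @ [?R]) u - D / 2) \<le> residue (?Ss @ [S]) (?Rs @ [?R]) u"
        unfolding residue_def by (simp add: mult_le_cancel_left1)
      then show ?thesis using lt powr_ge[of "deg (?Rs @ [?R]) u"] by linarith
    next
      case False
      have "\<forall>T\<in>set (?Rs @ [?R]). u \<notin> T"
        using lR L'(3) False by (auto simp: legal_def)
      then have "deg (?Rs @ [?R]) u = 0" by (simp add: deg_def filter_empty_conv)
      then show ?thesis using D_big by simp
    qed
    have "0 \<le> ?P" unfolding potential_def by (intro add_nonneg_nonneg nn sum_nonneg residue_nonneg)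
    then have "card ?R \<le> D / 2" using P'(1) powr_ge[of "card ?R"] by linarith
    then have legR: "legal n (D / 2) (map left (g @ [(S, f)]))"
      using lR L'(3) len degR by (auto simp: legal_def leftf)
    have "extends n (D / 2) C g S f"
      unfolding extends_def
    proof (intro conjI legR domf)
      show "ran f \<subseteq> {..<C}" using f(1) by (auto simp: ran_def)
      show "inj_on f (dom f)"
      proof (rule inj_onI)
        fix u v assume "u \<in> dom f" "v \<in> dom f" "f u = f v"
        then obtain c where "f u = Some c" "f v = Some c" by auto
        from this[THEN f(2)] show "u = v" by simp
      qed
      show "\<forall>(S', f')\<in>set g. \<forall>u\<in>dom f \<inter> dom f'. f u \<noteq> f' u"
      proof clarify
        fix S' f' u c c' assume m: "(S', f') \<in> set g" and c: "f u = Some c" "f' u = Some c'" "f u = f' u"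
        then have "y u c = 0" using used[OF m] by simp
        then show False using rate_pos(2)[OF c(1)] by simp
      qed
    qed
    moreover have "Inv (g @ [(S, f)])"
      unfolding Inv_def
    proof (intro exI[of _ ?y] conjI legR ballI)
      show "valid ?y (map fst (g @ [(S, f)]))" using v' by simp
      show "potential ?y (map fst (g @ [(S, f)])) (map left (g @ [(S, f)]))
        \<le> 3 / 8 + length (g @ [(S, f)]) / (8 * n)" using P'(2) by (simp add: leftf add.commute)
      fix x assume x: "x \<in> set (g @ [(S, f)])"
      have "?y u c = 0" if "snd x u = Some c" for u c
      proof (cases "x = (S, f)")
        case True
        then show ?thesis using that f(2) by (simp add: upd_def)
      next
        case False
        then have "y u c = 0" using x used[of "fst x" "snd x"] that by simp
        then show ?thesis by (simp add: upd_def)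
      qed
      then show "case x of (S, f) \<Rightarrow> \<forall>u c. f u = Some c \<longrightarrow> ?y u c = 0" by (simp add: split_beta)
    qed
    ultimately show ?thesis by blast
  qed
  ultimately show ?thesis unfolding reducible_def by blast
qed

end

section \<open>The competitive ratio\<close>

text \<open>The ratio decreases in \<open>exp 1\<close>, and \<open>272 / 172\<close> exceeds
  \<open>158 / 100\<close>.\<close>

lemma exp_ratio_ge: "158 / 100 \<le> exp 1 / (exp 1 - 1 :: real)"
proof -
  have "1 < exp (1 :: real)" by simp
  then show ?thesis using e_less_272 by (simp add: field_simps)
qed

text \<open>Once the root reaches 1/200, the additive term is at least 1/2 and greedy coloring
  suffices. Otherwise \<Delta> is at least \<open>200 ^ 11 * ln n\<close>, enough for all three
  halving rounds.\<close>

lemma reducible_e_ratio: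
  assumes n: "2 \<le> n"
  shows "\<exists>C. reducible n (real \<Delta>) C 0
    \<and> C \<le> (exp 1 / (exp 1 - 1) + 100 * root 11 (ln n / \<Delta>)) * \<Delta>"
proof (cases "\<Delta> = 0 \<or> 1 / 200 \<le> root 11 (ln n / \<Delta>)")
  case True
  have "real (2 * nat \<lfloor>real \<Delta>\<rfloor>) \<le> (exp 1 / (exp 1 - 1) + 100 * root 11 (ln n / \<Delta>)) * \<Delta>"
  proof (cases "\<Delta> = 0")
    case False
    then have "2 \<le> exp 1 / (exp 1 - 1) + 100 * root 11 (ln n / \<Delta>)"
      using True exp_ratio_ge by linarith
    then show ?thesis by (simp add: mult_right_mono)
  qed simp
  moreover have "reducible n (real \<Delta>) (2 * nat \<lfloor>real \<Delta>\<rfloor>) 0" by (intro reducible_greedy) simp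
  ultimately show ?thesis by blast
next
  case False
  have l: "1 / 2 \<le> ln (real n)"
  proof -
    have "ln 2 \<le> ln (real n)" using n by simp
    then show ?thesis using ln2_ge_two_thirds by linarith
  qed
  have root0: "0 \<le> root 11 (ln n / \<Delta>)" using l by simp
  have "ln n / \<Delta> = root 11 (ln n / \<Delta>) ^ 11" using l by simp
  also have "\<dots> \<le> (1 / 200) ^ 11" using False root0 by (intro power_mono) auto
  finally have "200 ^ 11 * ln n \<le> \<Delta>" using False by (simp add: field_simps)
  then have \<Delta>: "4 * (10 ^ 10 * ln n) \<le> \<Delta>" using l by simp
  define D :: "nat \<Rightarrow> real" where "D i = \<Delta> / 2 ^ i" for i
  have ph: "phase n (D i)" if "i < 3" for i
  proof
    have "i = 0 \<or> i = 1 \<or> i = 2" using that by auto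
    then show "10 ^ 10 * ln n \<le> D i" using \<Delta> l by (auto simp: D_def)
  qed (fact n)
  define K where "K i = phase.C (D i)" for i
  have K: "real (K i) \<le> 3 / 4 * D i + 1" if "i < 3" for i
    unfolding K_def phase.C_def[OF ph[OF that]] using \<Delta> l
    by (simp add: D_def)
  have half: "reducible n (D i) (K i) (D (Suc i))" if "i < 3" for i
    using phase.reducible_half[OF ph[OF that]] by (simp add: K_def D_def mult.commute)
  have "reducible n (D 0) (K 0 + K 1 + K 2 + 2 * nat \<lfloor>D 3\<rfloor>) 0"
    using half[of 0] half[of 1] half[of 2] reducible_greedy[of "D 3" n]
    by (intro reducible_trans[where R = "D 3"] reducible_trans[where R = "D 2"]
        reducible_trans[where R = "D 1"]) (auto simp: D_def numeral_eq_Suc)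
  moreover have "real (K 0 + K 1 + K 2 + 2 * nat \<lfloor>D 3\<rfloor>)
    \<le> (exp 1 / (exp 1 - 1) + 100 * root 11 (ln n / \<Delta>)) * \<Delta>"
  proof -
    have "real (nat \<lfloor>D 3\<rfloor>) \<le> D 3" by (intro of_nat_floor) (simp add: D_def)
    \<comment> \<open>The rounds cost \<open>21 / 16 * \<Delta>\<close> plus 3 for rounding up, and
      greedy coloring adds at most \<open>\<Delta> / 4\<close>.\<close>
    then have "real (K 0 + K 1 + K 2 + 2 * nat \<lfloor>D 3\<rfloor>) \<le> 158 / 100 * \<Delta>"
      using K[of 0] K[of 1] K[of 2] \<Delta> l by (simp add: D_def)
    also have "\<dots> \<le> (exp 1 / (exp 1 - 1) + 100 * root 11 (ln n / \<Delta>)) * \<Delta>"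
    proof (rule mult_right_mono)
      show "158 / 100 \<le> exp 1 / (exp 1 - 1) + 100 * root 11 (ln n / \<Delta>)"
        using exp_ratio_ge root0 by linarith
    qed simp
    finally show ?thesis .
  qed
  ultimately show ?thesis by (intro exI) (auto simp: D_def)
qed

text \<open>Online degrees are the sizes of the neighborhoods, and offline degrees are the counts
  \<open>deg\<close>; offline indices from \<open>n\<close> on have no edges.\<close>

lemma legal_history:
  assumes "edges h \<subseteq> {..<n} \<times> {..<n}" "max_degree n (edges h) = \<Delta>" "length h = n"
  shows "legal n (real \<Delta>) (map fst h)"
proof -
  let ?M = "(\<lambda>t. card (edges h `` {t})) ` {..<n} \<union> (\<lambda>u. card ((edges h)\<inverse> `` {u})) ` {..<n}"
  have M: "x \<le> \<Delta>" if "x \<in> ?M" for x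
    using that assms(2) unfolding max_degree_def by (metis (no_types, lifting) Max_ge finite_UnI finite_imageI finite_lessThan)
  have sub: "u < n" if "t < n" "u \<in> fst (h ! t)" for t u
    using that assms(1,3) by (auto simp: edges_def)
  have "fst x \<subseteq> {..<n} \<and> card (fst x) \<le> \<Delta>" if "x \<in> set h" for x
  proof -
    obtain t where t: "t < n" "x = h ! t" using \<open>x \<in> set h\<close> assms(3) by (metis in_set_conv_nth)
    have "edges h `` {t} = fst x" using t assms(3) by (auto simp: edges_def)
    then have "card (fst x) \<in> ?M" using t(1) by (intro UnI1 image_eqI[of _ _ t]) auto
    then show ?thesis using M sub t by auto
  qed
  moreover have "deg (map fst h) u \<le> \<Delta>" for u
  proof -
    have d: "deg (map fst h) u = card {t. t < n \<and> u \<in> fst (h ! t)}"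
      by (simp add: deg_def length_filter_conv_card assms(3) cong: conj_cong)
    show ?thesis
    proof (cases "u < n")
      case True
      have "(edges h)\<inverse> `` {u} = {t. t < n \<and> u \<in> fst (h ! t)}"
        using assms(3) by (auto simp: edges_def)
      then have "deg (map fst h) u \<in> ?M" using d True by (intro UnI2 image_eqI[of _ _ u]) auto
      then show ?thesis by (rule M)
    next
      case False
      then have "{t. t < n \<and> u \<in> fst (h ! t)} = {}" using sub by blast
      then show ?thesis unfolding d by (simp only: card.empty)
    qed
  qed
  ultimately show ?thesis using assms(3) by (auto simp: legal_def)
qed

lemma run_deterministic:
  assumes "\<And>h S. draw A n \<Delta> h S = return_pmf 0"
  shows "\<exists>h. run A n \<Delta> adv t = return_pmf h \<and> length h = t"
proof (induction t)
  case (Suc t)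
  then obtain h where "run A n \<Delta> adv t = return_pmf h" "length h = t" by blast
  then show ?case using assms by (simp add: bind_return_pmf)
qed simp

theorem theorem3p2:
  shows "\<exists>A. online_edge_coloring_algorithm A
    \<and> competitive_whp A
        (\<lambda>n \<Delta>. exp 1 / (exp 1 - 1) + 100 * root 11 (ln (real n) / real \<Delta>))
        {(n, \<Delta>). n \<ge> 1 \<and> real \<Delta> \<ge> 10 ^ 11 * ln (real n)}
    \<and> (\<forall>D :: nat \<Rightarrow> nat. (\<lambda>n. real (D n)) \<in> \<omega>(\<lambda>n. ln (real n)) \<longrightarrow>
        (\<exists>\<epsilon> :: nat \<Rightarrow> real. \<epsilon> \<in> o(\<lambda>_. 1)
          \<and> competitive_whp A (\<lambda>n \<Delta>. exp 1 / (exp 1 - 1) + \<epsilon> n) {(n, D n) | n. n \<ge> 1}))"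
proof -
  define \<alpha> where "\<alpha> n \<Delta> = exp 1 / (exp 1 - 1) + 100 * root 11 (ln (real n) / real \<Delta>)" for n \<Delta> :: nat
  have "\<exists>C. reducible n (real \<Delta>) C 0 \<and> (2 \<le> n \<longrightarrow> C \<le> \<alpha> n \<Delta> * \<Delta>)" for n \<Delta>
    using reducible_e_ratio[of n \<Delta>] reducible_greedy[of "real \<Delta>" n] unfolding \<alpha>_def
    by (cases "2 \<le> n") auto
  then obtain C where C: "\<And>n \<Delta>. reducible n (real \<Delta>) (C n \<Delta>) 0"
    "\<And>n \<Delta>. 2 \<le> n \<Longrightarrow> C n \<Delta> \<le> \<alpha> n \<Delta> * \<Delta>" by metis
  have "\<exists>col. (\<forall>Ss t u. legal n \<Delta> Ss \<longrightarrow> t < length Ss \<longrightarrow> u \<in> Ss ! t \<longrightarrow> col (take (Suc t) Ss) u < C n \<Delta>)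
    \<and> (\<forall>Ss t. legal n \<Delta> Ss \<longrightarrow> t < length Ss \<longrightarrow> inj_on (col (take (Suc t) Ss)) (Ss ! t))
    \<and> (\<forall>Ss s t u. legal n \<Delta> Ss \<longrightarrow> s < t \<longrightarrow> t < length Ss \<longrightarrow> u \<in> Ss ! s \<inter> Ss ! t \<longrightarrow>
       col (take (Suc s) Ss) u \<noteq> col (take (Suc t) Ss) u)" for n \<Delta>
    by (rule reducible_strategy[OF C(1)[of n \<Delta>]]) blast
  then obtain col where
    col_less: "\<And>n \<Delta> Ss t u. legal n (real \<Delta>) Ss \<Longrightarrow> t < length Ss \<Longrightarrow> u \<in> Ss ! t \<Longrightarrow>
       col n \<Delta> (take (Suc t) Ss) u < C n \<Delta>"
    and col_inj: "\<And>n \<Delta> Ss t. legal n (real \<Delta>) Ss \<Longrightarrow> t < length Ss \<Longrightarrow>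
       inj_on (col n \<Delta> (take (Suc t) Ss)) (Ss ! t)"
    and col_neq: "\<And>n \<Delta> Ss s t u. legal n (real \<Delta>) Ss \<Longrightarrow> s < t \<Longrightarrow> t < length Ss \<Longrightarrow>
       u \<in> Ss ! s \<inter> Ss ! t \<Longrightarrow> col n \<Delta> (take (Suc s) Ss) u \<noteq> col n \<Delta> (take (Suc t) Ss) u"
    by metis
  \<comment> \<open>The draws are constant, so each adversary produces a single history, and bounds
    valid on every legal input hold against it.\<close>
  define A where "A = \<lparr>draw = \<lambda>_ _ _ _. return_pmf 0,
    color = \<lambda>n \<Delta> h S _ u. col n \<Delta> (map fst h @ [S]) u\<rparr>"
  have coloring: "coloring A n \<Delta> h (t, u) = col n \<Delta> (take (Suc t) (map fst h)) u" if "t < length h" for n \<Delta> h t u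
    using that by (simp add: coloring_def A_def take_map take_Suc_conv_app_nth)
  have run: "\<exists>h. run A n \<Delta> adv n = return_pmf h \<and> length h = n \<and> legal n \<Delta> (map fst h)"
    if "legal_adversary A n \<Delta> adv" for n \<Delta> adv
  proof -
    obtain h where h: "run A n \<Delta> adv n = return_pmf h" "length h = n"
      using run_deterministic[of A n \<Delta> adv n] by (auto simp: A_def)
    then show ?thesis using that legal_history[of h n \<Delta>] by (auto simp: legal_adversary_def)
  qed
  have "online_edge_coloring_algorithm A"
    unfolding online_edge_coloring_algorithm_def
  proof (intro allI impI ballI)
    fix n \<Delta> adv h assume "n \<ge> 1 \<and> legal_adversary A n \<Delta> adv" "h \<in> set_pmf (run A n \<Delta> adv n)"
    then have L: "legal n \<Delta> (map fst h)" using run[of n \<Delta> adv] by auto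
    have neq: "coloring A n \<Delta> h (s, u) \<noteq> coloring A n \<Delta> h (t, u)"
      if "(s, u) \<in> edges h" "(t, u) \<in> edges h" "s < t" for s t u
      using col_neq[OF L that(3)] that by (simp add: edges_def coloring)
    show "proper_edge_coloring (edges h) (coloring A n \<Delta> h)"
      unfolding proper_edge_coloring_def
    proof (intro ballI impI)
      fix e e' assume e: "e \<in> edges h" "e' \<in> edges h" "e \<noteq> e' \<and> (fst e = fst e' \<or> snd e = snd e')"
      obtain t u t' u' where eq: "e = (t, u)" "e' = (t', u')" by fastforce
      show "coloring A n \<Delta> h e \<noteq> coloring A n \<Delta> h e'"
      proof (cases "t = t'")
        case True
        then have "t < length h" "u \<in> fst (h ! t)" "u' \<in> fst (h ! t)" "u \<noteq> u'"
          using e eq by (auto simp: edges_def)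
        then show ?thesis using col_inj[OF L, of t] True
          by (auto simp: eq coloring inj_on_def)
      next
        case False
        then have "u = u'" using e eq by auto
        then show ?thesis using neq[of t u t'] neq[of t' u t] e eq False by (metis linorder_less_linear)
      qed
    qed
  qed
  \<comment> \<open>General \<open>\<beta>\<close> and \<open>P\<close> serve both parameter ranges
    of the theorem; the exponent is \<open>c = 2\<close>.\<close>
  moreover have comp: "competitive_whp A \<beta> P"
    if P: "\<And>n \<Delta>. (n, \<Delta>) \<in> P \<Longrightarrow> 1 \<le> n \<and> (2 \<le> n \<longrightarrow> \<beta> n \<Delta> = \<alpha> n \<Delta>)" for \<beta> P
    unfolding competitive_whp_def
  proof (intro exI[of _ 2] conjI ballI)
    fix x assume x: "x \<in> P"
    obtain n \<Delta> where nx: "x = (n, \<Delta>)" by fastforce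
    have "1 - 1 / real n powr 2 \<le> measure_pmf.prob (run A n \<Delta> adv n)
        {h. real (card (coloring A n \<Delta> h ` edges h)) \<le> \<beta> n \<Delta> * real \<Delta>}"
      if "legal_adversary A n \<Delta> adv" for adv
    \<comment> \<open>For \<open>n = 1\<close> the required probability is
      \<open>1 - 1 = 0\<close>.\<close>
    proof (cases "n = 1")
      case False
      then have n2: "2 \<le> n" "\<beta> n \<Delta> = \<alpha> n \<Delta>" using P x nx by fastforce+
      obtain h where h: "run A n \<Delta> adv n = return_pmf h" "length h = n" "legal n \<Delta> (map fst h)"
        using run \<open>legal_adversary A n \<Delta> adv\<close> by blast
      have "coloring A n \<Delta> h ` edges h \<subseteq> {..<C n \<Delta>}"
        using col_less[OF h(3)] by (auto simp: edges_def coloring)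
      then have "card (coloring A n \<Delta> h ` edges h) \<le> C n \<Delta>"
        by (metis card_lessThan card_mono finite_lessThan)
      then have "real (card (coloring A n \<Delta> h ` edges h)) \<le> \<beta> n \<Delta> * real \<Delta>"
        using C(2)[OF n2(1), of \<Delta>] n2(2) by simp
      then show ?thesis by (simp add: h(1) measure_return_pmf)
    qed simp
    then show "case x of (n, \<Delta>) \<Rightarrow> \<forall>adv. legal_adversary A n \<Delta> adv \<longrightarrow>
        measure_pmf.prob (run A n \<Delta> adv n)
          {h. real (card (coloring A n \<Delta> h ` edges h)) \<le> \<beta> n \<Delta> * real \<Delta>}
        \<ge> 1 - 1 / real n powr 2" by (simp add: nx)
  qed simp
  moreover have "\<exists>\<epsilon> :: nat \<Rightarrow> real. \<epsilon> \<in> o(\<lambda>_. 1)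
      \<and> competitive_whp A (\<lambda>n \<Delta>. exp 1 / (exp 1 - 1) + \<epsilon> n) {(n, D n) | n. n \<ge> 1}"
    if "(\<lambda>n. real (D n)) \<in> \<omega>(\<lambda>n. ln (real n))" for D :: "nat \<Rightarrow> nat"
  proof (intro exI conjI)
    \<comment> \<open>Along \<open>\<Delta> = D n\<close> the additive term depends on
      \<open>n\<close> alone, and it vanishes since \<open>ln n\<close> is of smaller order than
      \<open>D n\<close>.\<close>
    let ?\<epsilon> = "\<lambda>n. 100 * root 11 (ln (real n) / real (D n))"
    have "(\<lambda>n. ln (real n) / real (D n)) \<longlonglongrightarrow> 0"
      using that by (intro smalloD_tendsto) (simp add: smallomega_iff_smallo)
    then have "?\<epsilon> \<longlonglongrightarrow> 100 * root 11 0" by (intro tendsto_intros)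
    then show "?\<epsilon> \<in> o(\<lambda>_. 1)" by (intro smalloI_tendsto) auto
    show "competitive_whp A (\<lambda>n \<Delta>. exp 1 / (exp 1 - 1) + ?\<epsilon> n) {(n, D n) | n. n \<ge> 1}"
      by (rule comp) (auto simp: \<alpha>_def)
  qed
  moreover have "competitive_whp A
        (\<lambda>n \<Delta>. exp 1 / (exp 1 - 1) + 100 * root 11 (ln (real n) / real \<Delta>))
        {(n, \<Delta>). n \<ge> 1 \<and> real \<Delta> \<ge> 10 ^ 11 * ln (real n)}"
    by (rule comp) (auto simp: \<alpha>_def)
  ultimately show ?thesis by blast
qed

end
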